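(* Let $N \cong \mathbb{Z}^2$ be a lattice of rank $2$, let $\Sigma$ be a complete fan in $N_{\mathbb{R}} = N \otimes_{\mathbb{Z}} \mathbb{R}$, let $\Sigma(1)$ be the set of primitive generators in $N$ of the 1-dimensional cones of $\Sigma$, and let $X = X(\Sigma)$ be the corresponding toric variety, so $\dim(X)=2$. If $\Sigma(1)$ is $2$-regular, then $X$ is diagonally split at $q$ for all odd integers $q \geq 3$.
   Context: $k$-regular: for a lattice $N$ of rank $n$ and a positive integer $k$, $\Sigma(1)$ is $k$-regular if, for every maximal linearly independent subset $\{v_1,\dots,v_n\}$ of $\Sigma(1)$, the quotient $N/\langle v_1,\dots,v_n\rangle$ is $k$-torsion, i.e., annihilated by $k$ (here $\langle v_1,\dots,v_n\rangle$ is the subgroup generated by the $v_i$). Diagonal splittings: let $X$ be a toric variety (over a field) given by a complete fan $\Sigma$. For an integer $q\ge 2$, multiplication by $q$ on $N_{\mathbb{R}}$ preserves $\Sigma$ and induces a morphism $F\colon X\to X$. A splitting of $X$ at $q$ is an $\mathcal{O}_X$-module map $\pi\colon F_*\mathcal{O}_X\to\mathcal{O}_X$ whose composition with the natural map $\mathcal{O}_X\to F_*\mathcal{O}_X$ is the identity. It is compatible with a subvariety $Z\subset X$ with ideal sheaf $I_Z$ if $\pi(F_*I_Z)\subset I_Z$. The toric variety $X$ is diagonally split at $q$ if there is a splitting at $q$ of the toric variety $X\times X$ compatible with the diagonal $\Delta\subset X\times X$. Recalled known characterization (from earlier work of Payne): with $M=\operatorname{Hom}(N,\mathbb{Z})$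 and $M_{\mathbb{R}}=M\otimes_{\mathbb{Z}}\mathbb{R}$, $X$ is diagonally split at $q\ge 2$ if and only if the open polytope $\mathbb{F}_\Sigma=\{u\in M_{\mathbb{R}} : |\langle u,v\rangle|<1 \text{ for all } v\in\Sigma(1)\}$ contains a representative of every class in $\frac{1}{q}M/M$. *)

theory Defs
  imports
    "HOL-Analysis.Analysis"
    "HOL-Algebra.RingHom"
    "HOL-Library.Poly_Mapping"
    "HOL-Computational_Algebra.Fraction_Field"
begin

section \<open>Lattices and fans\<close>

text \<open>
  A lattice \<open>N\<close> of rank \<open>n\<close> is realised inside \<open>N_R\<close>, a Euclidean space of dimension \<open>n\<close>. The inner
  product identifies \<open>M_R\<close> with \<open>N_R\<close> and \<open>M = Hom(N, Z)\<close> with the dual lattice.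
\<close>

definition int_span :: "'v::real_vector set \<Rightarrow> 'v set" where
  "int_span B = {(\<Sum>b\<in>F. of_int (c b) *\<^sub>R b) | F c. finite F \<and> F \<subseteq> B}"

definition is_lattice :: "'v::euclidean_space set \<Rightarrow> bool" where
  "is_lattice N \<longleftrightarrow> (\<exists>B. independent B \<and> span B = UNIV \<and> N = int_span B)"

definition dual_lattice :: "'v::euclidean_space set \<Rightarrow> 'v set" where
  "dual_lattice N = {u. \<forall>v\<in>N. u \<bullet> v \<in> \<int>}"

definition rational_cone :: "'v::euclidean_space set \<Rightarrow> 'v set \<Rightarrow> bool" where
  "rational_cone N \<sigma> \<longleftrightarrow> (\<exists>S. finite S \<and> S \<subseteq> N \<and> \<sigma> = convex_cone hull S)"

definition strongly_convex :: "'v::euclidean_space set \<Rightarrow> bool" where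
  "strongly_convex \<sigma> \<longleftrightarrow> \<sigma> \<inter> uminus ` \<sigma> = {0}"

text \<open>The library's \<open>face_of\<close> also counts the empty set as a face; a face of a cone is nonempty.\<close>

definition cone_face :: "'v::euclidean_space set \<Rightarrow> 'v set \<Rightarrow> bool" where
  "cone_face \<tau> \<sigma> \<longleftrightarrow> \<tau> face_of \<sigma> \<and> \<tau> \<noteq> {}"

definition is_fan :: "'v::euclidean_space set \<Rightarrow> 'v set set \<Rightarrow> bool" where
  "is_fan N \<Sigma> \<longleftrightarrow> finite \<Sigma> \<and>
     (\<forall>\<sigma>\<in>\<Sigma>. rational_cone N \<sigma> \<and> strongly_convex \<sigma>) \<and>
     (\<forall>\<sigma>\<in>\<Sigma>. \<forall>\<tau>. cone_face \<tau> \<sigma> \<longrightarrow> \<tau> \<in> \<Sigma>) \<and>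
     (\<forall>\<sigma>\<in>\<Sigma>. \<forall>\<tau>\<in>\<Sigma>. cone_face (\<sigma> \<inter> \<tau>) \<sigma> \<and> cone_face (\<sigma> \<inter> \<tau>) \<tau>)"

definition complete_fan :: "'v::euclidean_space set \<Rightarrow> 'v set set \<Rightarrow> bool" where
  "complete_fan N \<Sigma> \<longleftrightarrow> is_fan N \<Sigma> \<and> \<Union>\<Sigma> = UNIV"

definition product_fan :: "'v::euclidean_space set set \<Rightarrow> 'w::euclidean_space set set \<Rightarrow> ('v \<times> 'w) set set" where
  "product_fan \<Sigma> \<Sigma>' = {\<sigma> \<times> \<tau> | \<sigma> \<tau>. \<sigma> \<in> \<Sigma> \<and> \<tau> \<in> \<Sigma>'}"

definition primitive :: "'v::euclidean_space set \<Rightarrow> 'v \<Rightarrow> bool" where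
  "primitive N v \<longleftrightarrow> v \<in> N \<and> v \<noteq> 0 \<and> (\<forall>w\<in>N. \<forall>m::int. v = of_int m *\<^sub>R w \<longrightarrow> \<bar>m\<bar> = 1)"

definition rays :: "'v::euclidean_space set \<Rightarrow> 'v set set \<Rightarrow> 'v set" where
  "rays N \<Sigma> = {v. primitive N v \<and> (\<exists>\<rho>\<in>\<Sigma>. dim \<rho> = 1 \<and> v \<in> \<rho>)}"

definition k_regular :: "nat \<Rightarrow> 'v::euclidean_space set \<Rightarrow> 'v set \<Rightarrow> bool" where
  "k_regular k N R \<longleftrightarrow>
     (\<forall>B. B \<subseteq> R \<and> independent B \<and> (\<forall>C. B \<subset> C \<and> C \<subseteq> R \<longrightarrow> \<not> independent C)
        \<longrightarrow> (\<forall>x\<in>N. of_nat k *\<^sub>R x \<in> int_span B))"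


section \<open>Group algebras\<close>

text \<open>
  The group algebra of the additive group of \<open>M_R\<close>. It contains all rings \<open>k[S]\<close> for
  submonoids \<open>S\<close> of \<open>M\<close>. It is a copy of the library's finitely supported functions because the
  \<open>idom\<close> instance there needs linearly ordered exponents.
\<close>

typedef (overloaded) ('v, 'k) laurent = "UNIV :: ('v::euclidean_space \<Rightarrow>\<^sub>0 'k::field) set"
  morphisms coeffs Laurent ..

setup_lifting type_definition_laurent

lemma poly_mapping_mult_nonzero:
  fixes f g :: "'v::euclidean_space \<Rightarrow>\<^sub>0 'k::field"
  assumes "f \<noteq> 0" "g \<noteq> 0"
  shows "f * g \<noteq> 0"
proof -
  let ?A = "Poly_Mapping.keys f" and ?B = "Poly_Mapping.keys g"
  define D where "D = {x - y | x y. x \<in> ?A \<union> ?B \<and> y \<in> ?A \<union> ?B} - {0}"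
  have "D \<subseteq> (\<lambda>(x, y). x - y) ` ((?A \<union> ?B) \<times> (?A \<union> ?B))"
    by (auto simp: D_def)
  then have finD: "finite D"
    by (rule finite_subset) auto
  have "negligible (\<Union>d\<in>D. {x. d \<bullet> x = 0})"
    using finD by (intro negligible_Union) (auto simp: D_def intro!: negligible_hyperplane)
  then have "(\<Union>d\<in>D. {x. d \<bullet> x = 0}) \<noteq> UNIV"
    by (metis non_negligible_UNIV)
  then obtain c where c: "\<And>d. d \<in> D \<Longrightarrow> d \<bullet> c \<noteq> 0"
    by auto
  have inj: "x = y" if "x \<in> ?A \<union> ?B" "y \<in> ?A \<union> ?B" "x \<bullet> c = y \<bullet> c" for x y
  proof (rule ccontr)
    assume "x \<noteq> y"
    then have "x - y \<in> D" using that by (auto simp: D_def)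
    with c[of "x - y"] that(3) show False by (simp add: inner_diff_left)
  qed
  have top: "\<exists>a\<in>S. \<forall>x\<in>S. x \<noteq> a \<longrightarrow> x \<bullet> c < a \<bullet> c"
    if "finite S" "S \<noteq> {}" "S \<subseteq> ?A \<union> ?B" for S
  proof -
    have "Max ((\<lambda>x. x \<bullet> c) ` S) \<in> (\<lambda>x. x \<bullet> c) ` S"
      using that by (intro Max_in) auto
    then obtain a where a: "a \<in> S" "Max ((\<lambda>x. x \<bullet> c) ` S) = a \<bullet> c" by auto
    have "x \<bullet> c \<le> a \<bullet> c" if "x \<in> S" for x
      using a \<open>finite S\<close> that by (metis Max_ge finite_imageI imageI)
    then show ?thesis
      using a(1) inj that(3) by (metis less_eq_real_def subsetD)
  qed
  obtain a where a: "a \<in> ?A" "\<And>x. x \<in> ?A \<Longrightarrow> x \<noteq> a \<Longrightarrow> x \<bullet> c < a \<bullet> c"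
    using top[of ?A] assms by auto
  obtain b where b: "b \<in> ?B" "\<And>x. x \<in> ?B \<Longrightarrow> x \<noteq> b \<Longrightarrow> x \<bullet> c < b \<bullet> c"
    using top[of ?B] assms by auto
  have uniq: "x = a \<and> y = b" if "x \<in> ?A" "y \<in> ?B" "a + b = x + y" for x y
    by (smt (verit) a(2) b(2) inner_add_left that)
  have "Poly_Mapping.lookup (f * g) (a + b) = (\<Sum>l. Poly_Mapping.lookup f l * (\<Sum>q. Poly_Mapping.lookup g q when a + b = l + q))"
    by (rule lookup_mult)
  also have "\<dots> = (\<Sum>l. (Poly_Mapping.lookup f a * Poly_Mapping.lookup g b) when l = a)"
  proof (rule Sum_any.cong)
    fix l
    have "(\<Sum>q. Poly_Mapping.lookup g q when a + b = l + q) = (\<Sum>q. Poly_Mapping.lookup g (a + b - l) when q = a + b - l)"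
      by (rule Sum_any.cong) (auto simp: when_def)
    also have "\<dots> = Poly_Mapping.lookup g (a + b - l)"
      by simp
    finally have *: "(\<Sum>q. Poly_Mapping.lookup g q when a + b = l + q) = Poly_Mapping.lookup g (a + b - l)" .
    show "Poly_Mapping.lookup f l * (\<Sum>q. Poly_Mapping.lookup g q when a + b = l + q) = (Poly_Mapping.lookup f a * Poly_Mapping.lookup g b when l = a)"
    proof (cases "l = a")
      case True
      then show ?thesis by (simp add: *)
    next
      case False
      then have "l \<notin> ?A \<or> a + b - l \<notin> ?B" using uniq[of l "a + b - l"] by auto
      then show ?thesis using False by (auto simp: * in_keys_iff)
    qed
  qed
  also have "\<dots> = Poly_Mapping.lookup f a * Poly_Mapping.lookup g b"
    by simp
  also have "\<dots> \<noteq> 0"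
    using a(1) b(1) by (simp add: in_keys_iff)
  finally show ?thesis by auto
qed

instantiation laurent :: (euclidean_space, field) idom
begin

lift_definition zero_laurent :: "('a, 'b) laurent" is 0 .
lift_definition one_laurent :: "('a, 'b) laurent" is 1 .
lift_definition plus_laurent :: "('a, 'b) laurent \<Rightarrow> ('a, 'b) laurent \<Rightarrow> ('a, 'b) laurent" is "(+)" .
lift_definition minus_laurent :: "('a, 'b) laurent \<Rightarrow> ('a, 'b) laurent \<Rightarrow> ('a, 'b) laurent" is "(-)" .
lift_definition uminus_laurent :: "('a, 'b) laurent \<Rightarrow> ('a, 'b) laurent" is uminus .
lift_definition times_laurent :: "('a, 'b) laurent \<Rightarrow> ('a, 'b) laurent \<Rightarrow> ('a, 'b) laurent" is "(*)" .

instance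
proof
  fix a b c :: "('a, 'b) laurent"
  show "a * b * c = a * (b * c)" by transfer (rule mult.assoc)
  show "a * b = b * a" by transfer (rule mult.commute)
  show "1 * a = a" by transfer simp
  show "(a + b) * c = a * c + b * c" by transfer (rule distrib_right)
  show "a * (b + c) = a * b + a * c" by transfer (rule distrib_left)
  show "0 * a = 0" by transfer simp
  show "a * 0 = 0" by transfer simp
  show "a + b + c = a + (b + c)" by transfer (rule add.assoc)
  show "a + b = b + a" by transfer (rule add.commute)
  show "0 + a = a" by transfer simp
  show "- a + a = 0" by transfer simp
  show "a - b = a + - b" by transfer simp
  show "(0 :: ('a, 'b) laurent) \<noteq> 1" by transfer simp
  show "a \<noteq> 0 \<Longrightarrow> b \<noteq> 0 \<Longrightarrow> a * b \<noteq> 0" by transfer (rule poly_mapping_mult_nonzero)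
qed

end

definition monomial :: "'v::euclidean_space \<Rightarrow> 'k::field \<Rightarrow> ('v, 'k) laurent" where
  "monomial u c = Laurent (Poly_Mapping.single u c)"

text \<open>
  A linear map \<open>h : N_R \<rightarrow> N'_R\<close> mapping \<open>N\<close> to \<open>N'\<close> has as its dual \<open>M' \<rightarrow> M\<close> the adjoint of \<open>h\<close>;
  the corresponding map of group algebras is \<open>x\<^sup>u \<mapsto> x\<^sup>h\<^sup>*\<^sup>u\<close>.
\<close>

definition comorphism ::
  "('v::euclidean_space \<Rightarrow> 'w::euclidean_space) \<Rightarrow> ('w, 'k::field) laurent \<Rightarrow> ('v, 'k) laurent" where
  "comorphism h f = (\<Sum>u\<in>Poly_Mapping.keys (coeffs f). monomial (adjoint h u) (Poly_Mapping.lookup (coeffs f) u))"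

text \<open>The extension of an injective ring homomorphism to fraction fields.\<close>

definition fract_map :: "('a::idom \<Rightarrow> 'b::idom) \<Rightarrow> 'a fract \<Rightarrow> 'b fract" where
  "fract_map \<phi> x = (THE y. \<exists>a b. b \<noteq> 0 \<and> x = Fract a b \<and> y = Fract (\<phi> a) (\<phi> b))"

lemma fract_map_Fract:
  assumes "\<And>a b. \<phi> (a * b) = \<phi> a * \<phi> b" "\<And>a. \<phi> a = 0 \<Longrightarrow> a = 0" "b \<noteq> 0"
  shows "fract_map \<phi> (Fract a b) = Fract (\<phi> a) (\<phi> b)"
  unfolding fract_map_def
proof (rule the_equality)
  show "\<exists>a' b'. b' \<noteq> 0 \<and> Fract a b = Fract a' b' \<and> Fract (\<phi> a) (\<phi> b) = Fract (\<phi> a') (\<phi> b')"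
    using assms(3) by blast
next
  fix y
  assume "\<exists>a' b'. b' \<noteq> 0 \<and> Fract a b = Fract a' b' \<and> y = Fract (\<phi> a') (\<phi> b')"
  then obtain a' b' where *: "b' \<noteq> 0" "Fract a b = Fract a' b'" "y = Fract (\<phi> a') (\<phi> b')"
    by blast
  then have "a * b' = a' * b"
    using assms(3) by (simp add: eq_fract)
  then have "\<phi> a * \<phi> b' = \<phi> a' * \<phi> b"
    using assms(1) by metis
  moreover have "\<phi> b \<noteq> 0" "\<phi> b' \<noteq> 0"
    using assms(2,3) *(1) by auto
  ultimately show "y = Fract (\<phi> a) (\<phi> b)"
    using *(3) by (simp add: eq_fract)
qed


section \<open>Toric varieties\<close>

text \<open>
  The toric variety \<open>X(\<Sigma>)\<close> over \<open>k\<close> is the integral separated scheme glued from the charts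
  \<open>Spec k[\<sigma>\<^sup>\<or> \<inter> M]\<close>, \<open>\<sigma> \<in> \<Sigma>\<close>. Points of an integral separated scheme are determined by their local
  rings inside the function field, so a point is represented here by its local ring; two points of
  two charts are glued iff they have the same local ring. Sections over a nonempty open set \<open>U\<close> are
  the rational functions that are regular at every point of \<open>U\<close>.
\<close>

definition dual_cone :: "'v::euclidean_space set \<Rightarrow> 'v set" where
  "dual_cone \<sigma> = {u. \<forall>v\<in>\<sigma>. 0 \<le> u \<bullet> v}"

definition chart_ring :: "'v::euclidean_space set \<Rightarrow> 'v set \<Rightarrow> ('v, 'k::field) laurent ring" where
  "chart_ring N \<sigma> =
     \<lparr>carrier = {f. Poly_Mapping.keys (coeffs f) \<subseteq> dual_cone \<sigma> \<inter> dual_lattice N},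
      monoid.mult = (*), one = 1, zero = 0, add = (+)\<rparr>"

definition chart_spec :: "'v::euclidean_space set \<Rightarrow> 'v set \<Rightarrow> ('v, 'k::field) laurent set set" where
  "chart_spec N \<sigma> = {P. primeideal P (chart_ring N \<sigma>)}"

definition local_ring ::
  "'v::euclidean_space set \<Rightarrow> 'v set \<Rightarrow> ('v, 'k::field) laurent set \<Rightarrow> ('v, 'k) laurent fract set" where
  "local_ring N \<sigma> P =
     {Fract a b | a b. a \<in> carrier (chart_ring N \<sigma>) \<and> b \<in> carrier (chart_ring N \<sigma>) - P}"

definition toric_points ::
  "'v::euclidean_space set \<Rightarrow> 'v set set \<Rightarrow> ('v, 'k::field) laurent fract set set" where
  "toric_points N \<Sigma> = {local_ring N \<sigma> P | \<sigma> P. \<sigma> \<in> \<Sigma> \<and> P \<in> chart_spec N \<sigma>}"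

text \<open>The Zariski topology: open sets are those that are open in every chart.\<close>

definition toric_open ::
  "'v::euclidean_space set \<Rightarrow> 'v set set \<Rightarrow> ('v, 'k::field) laurent fract set set \<Rightarrow> bool" where
  "toric_open N \<Sigma> U \<longleftrightarrow> U \<subseteq> toric_points N \<Sigma> \<and>
     (\<forall>\<sigma>\<in>\<Sigma>. \<exists>E \<subseteq> carrier (chart_ring N \<sigma>). \<forall>P\<in>chart_spec N \<sigma>.
        local_ring N \<sigma> P \<in> U \<longleftrightarrow> \<not> E \<subseteq> P)"

definition sections :: "'a::field set set \<Rightarrow> 'a set" where
  "sections U = \<Inter>U"

definition maximal_ideal :: "'a::field set \<Rightarrow> 'a set" where
  "maximal_ideal x = {f \<in> x. \<not> (\<exists>g\<in>x. f * g = 1)}"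

text \<open>The sections over \<open>U\<close> of the ideal sheaf of a subvariety with set of points \<open>Z\<close>.\<close>

definition ideal_sections :: "'a::field set set \<Rightarrow> 'a set set \<Rightarrow> 'a set" where
  "ideal_sections Z U = {f \<in> sections U. \<forall>z \<in> Z \<inter> U. f \<in> maximal_ideal z}"

text \<open>
  The graph on points of the toric morphism \<open>X(\<Sigma>) \<rightarrow> X(\<Sigma>')\<close> induced by a linear map \<open>h\<close>: whenever
  \<open>h\<close> maps \<open>\<sigma>\<close> into \<open>\<tau>\<close>, it is given on charts by the ring homomorphism
  \<open>k[\<tau>\<^sup>\<or> \<inter> M'] \<rightarrow> k[\<sigma>\<^sup>\<or> \<inter> M]\<close>, i.e. by the inverse image of prime ideals.
\<close>

definition toric_morphism ::
  "('v::euclidean_space \<Rightarrow> 'w::euclidean_space) \<Rightarrow> 'v set \<Rightarrow> 'v set set \<Rightarrow> 'w set \<Rightarrow> 'w set set \<Rightarrow>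
   (('v, 'k::field) laurent fract set \<times> ('w, 'k) laurent fract set) set" where
  "toric_morphism h N \<Sigma> N' \<Sigma>' =
     {(local_ring N \<sigma> P, local_ring N' \<tau> {f \<in> carrier (chart_ring N' \<tau>). comorphism h f \<in> P}) | \<sigma> \<tau> P.
        \<sigma> \<in> \<Sigma> \<and> \<tau> \<in> \<Sigma>' \<and> h ` \<sigma> \<subseteq> \<tau> \<and> P \<in> chart_spec N \<sigma>}"


section \<open>Splittings\<close>

definition F_vimage ::
  "int \<Rightarrow> 'v::euclidean_space set \<Rightarrow> 'v set set \<Rightarrow> ('v, 'k::field) laurent fract set set \<Rightarrow>
   ('v, 'k) laurent fract set set" where
  "F_vimage q N \<Sigma> U = (toric_morphism (\<lambda>v. of_int q *\<^sub>R v) N \<Sigma> N \<Sigma>)\<inverse> `` U"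

definition F_pullback ::
  "int \<Rightarrow> ('v::euclidean_space, 'k::field) laurent fract \<Rightarrow> ('v, 'k) laurent fract" where
  "F_pullback q = fract_map (comorphism (\<lambda>v. of_int q *\<^sub>R v))"

text \<open>
  A splitting is a morphism of sheaves \<open>\<pi>\<close>, given by maps \<open>\<pi> U : O(F\<inverse> U) \<rightarrow> O(U)\<close>. Restriction maps
  of the structure sheaf are inclusions inside the function field. Only nonempty open sets are
  considered: over the empty set all sections are zero, and \<open>sections {}\<close> is not the zero ring.
\<close>

definition is_splitting ::
  "int \<Rightarrow> 'v::euclidean_space set \<Rightarrow> 'v set set \<Rightarrow>
   (('v, 'k::field) laurent fract set set \<Rightarrow> ('v, 'k) laurent fract \<Rightarrow> ('v, 'k) laurent fract) \<Rightarrow> bool" where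
  "is_splitting q N \<Sigma> \<pi> \<longleftrightarrow>
     (\<forall>U. toric_open N \<Sigma> U \<and> U \<noteq> {} \<longrightarrow>
        (\<forall>g \<in> sections (F_vimage q N \<Sigma> U). \<pi> U g \<in> sections U) \<and>
        (\<forall>g \<in> sections (F_vimage q N \<Sigma> U). \<forall>g' \<in> sections (F_vimage q N \<Sigma> U).
           \<pi> U (g + g') = \<pi> U g + \<pi> U g') \<and>
        (\<forall>f \<in> sections U. \<forall>g \<in> sections (F_vimage q N \<Sigma> U).
           \<pi> U (F_pullback q f * g) = f * \<pi> U g) \<and>
        (\<forall>V. toric_open N \<Sigma> V \<and> V \<noteq> {} \<and> V \<subseteq> U \<longrightarrow>
           (\<forall>g \<in> sections (F_vimage q N \<Sigma> U). \<pi> V g = \<pi> U g)) \<and>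
        (\<forall>f \<in> sections U. \<pi> U (F_pullback q f) = f))"

definition compatible ::
  "int \<Rightarrow> 'v::euclidean_space set \<Rightarrow> 'v set set \<Rightarrow> ('v, 'k::field) laurent fract set set \<Rightarrow>
   (('v, 'k) laurent fract set set \<Rightarrow> ('v, 'k) laurent fract \<Rightarrow> ('v, 'k) laurent fract) \<Rightarrow> bool" where
  "compatible q N \<Sigma> Z \<pi> \<longleftrightarrow>
     (\<forall>U. toric_open N \<Sigma> U \<and> U \<noteq> {} \<longrightarrow>
        \<pi> U ` ideal_sections Z (F_vimage q N \<Sigma> U) \<subseteq> ideal_sections Z U)"

text \<open>The image of the diagonal morphism \<open>X \<rightarrow> X \<times> X = X(\<Sigma> \<times> \<Sigma>)\<close>.\<close>

definition diagonal ::
  "'v::euclidean_space set \<Rightarrow> 'v set set \<Rightarrow> ('v \<times> 'v, 'k::field) laurent fract set set" where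
  "diagonal N \<Sigma> = Range (toric_morphism (\<lambda>v. (v, v)) N \<Sigma> (N \<times> N) (product_fan \<Sigma> \<Sigma>))"

definition diagonally_split ::
  "'k::field itself \<Rightarrow> 'v::euclidean_space set \<Rightarrow> 'v set set \<Rightarrow> int \<Rightarrow> bool" where
  "diagonally_split _ N \<Sigma> q \<longleftrightarrow>
     (\<exists>\<pi> :: ('v \<times> 'v, 'k) laurent fract set set \<Rightarrow> ('v \<times> 'v, 'k) laurent fract \<Rightarrow> ('v \<times> 'v, 'k) laurent fract.
        is_splitting q (N \<times> N) (product_fan \<Sigma> \<Sigma>) \<pi> \<and>
        compatible q (N \<times> N) (product_fan \<Sigma> \<Sigma>) (diagonal N \<Sigma>) \<pi>)"

end

(*
  A splitting of X x X at q is given on the torus by a map p of the group algebra that is additive and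
  satisfies p (F* f . g) = f . p g. It extends to a fraction a / F* h by p a / h. Every section over
  F^-1 U has this form near each point of U, so p gives a splitting of X x X as soon as p 1 = 1 and p
  preserves the coordinate rings of all charts. If r a / q represents the class of - a / q in
  (1/q) M / M and lies in the open polytope |<u, v>| < 1, then the map
    x^(a, b) |-> x^((a + r a) / q, (b - r a) / q) if a + b is in q M, and 0 otherwise,
  preserves the charts. Its restriction to the diagonal depends only on a + b, hence it is compatible
  with the diagonal.

  In rank two, 2-regularity bounds the determinants of pairs of rays by 2. This yields a basis of N
  in which all coordinates of the rays are 0, 1 or -1. In the dual basis of (1/q) M the
  representatives with coordinates of absolute value at most (q - 1) / (2 q) < 1/2 lie in the polytope.
*)

theory Submission
  imports Defs
begin

section \<open>Linear extensions of maps of exponents\<close>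

text \<open>Representatives strictly inside the polytope are wanted because of rounding: if
  \<open>a\<close> is nonnegative on a cone and \<open>(a + r a) / q\<close> lies in M, then its
  pairing with a ray of the cone is an integer greater than -1, hence nonnegative. On the second
  factor the correction enters with the opposite sign, so that the two cancel on the diagonal; the
  polytope is symmetric, so one bound serves both factors.

  A quotient killed by 2 could still be (Z/2)^2, of order 4. The two rays would then span 2 N and be
  divisible by 2, which primitivity forbids; this is how the bound 2 on determinants arises.

  If all coordinates of a ray are 0, 1 or -1, its pairing with a representative is at most the sum
  of the absolute values of two coordinates. For odd \<open>q\<close> centered residues keep this
  sum below 1; for even \<open>q\<close> a coordinate 1/2 can occur, and the sum can reach 1.

  Sections over F^-1 U are given only as fractions regular at every point. Denominators of the form
  F* h come from a conductor argument with a prime that avoids a multiplicative set.\<close>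

abbreviation supp :: "('v::euclidean_space, 'k::field) laurent \<Rightarrow> 'v set" where
  "supp f \<equiv> Poly_Mapping.keys (coeffs f)"

text \<open>Scalars act as monomials of degree zero, so that scalar multiplication is a product in
  the ring.\<close>

definition lext ::
  "('v::euclidean_space \<Rightarrow> ('w::euclidean_space, 'k::field) laurent) \<Rightarrow> ('v, 'k) laurent \<Rightarrow> ('w, 'k) laurent" where
  "lext \<phi> f = (\<Sum>u\<in>supp f. monomial 0 (Poly_Mapping.lookup (coeffs f) u) * \<phi> u)"

lemma monomial_0 [simp]: "monomial u 0 = 0"
  by (simp add: monomial_def zero_laurent_def)

lemma monomial_add: "monomial u (c + d) = monomial u c + monomial u d"
  by (simp add: monomial_def plus_laurent_def Laurent_inverse single_add)

lemma monomial_mult: "monomial u c * monomial v d = monomial (u + v) (c * d)"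
  by (simp add: monomial_def times_laurent_def Laurent_inverse mult_single)

lemma monomial_one [simp]: "monomial 0 1 = 1"
  by (simp add: monomial_def one_laurent_def)

lemma coeffs_monomial: "coeffs (monomial u c) = Poly_Mapping.single u c"
  by (simp add: monomial_def Laurent_inverse)

lemma supp_monomial: "supp (monomial u c) = (if c = 0 then {} else {u})"
  by (simp add: coeffs_monomial)

lemma supp_0 [simp]: "supp 0 = {}"
  by (simp add: zero_laurent.rep_eq)

lemma supp_1 [simp]: "supp 1 = {0}"
  by (simp add: one_laurent.rep_eq)

lemma supp_uminus [simp]: "supp (- f) = supp f"
  by (simp add: uminus_laurent.rep_eq in_keys_iff set_eq_iff)

lemma supp_add: "supp (f + g) \<subseteq> supp f \<union> supp g"
  by (simp add: plus_laurent.rep_eq keys_add)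

lemma supp_mult: "supp (f * g) \<subseteq> {a + b | a b. a \<in> supp f \<and> b \<in> supp g}"
  using keys_mult by (simp add: times_laurent.rep_eq)

lemma supp_sum: "supp (sum f I) \<subseteq> (\<Union>i\<in>I. supp (f i))"
proof (induction I rule: infinite_finite_induct)
  case (insert i I)
  then show ?case using supp_add[of "f i" "sum f I"] by auto
qed auto

lemma lext_0 [simp]: "lext \<phi> 0 = 0"
  by (simp add: lext_def)

lemma lext_monomial: "lext \<phi> (monomial u c) = monomial 0 c * \<phi> u"
  by (auto simp: lext_def coeffs_monomial)

lemma lext_add: "lext \<phi> (f + g) = lext \<phi> f + lext \<phi> g"
proof -
  let ?K = "supp f \<union> supp g"
  let ?t = "\<lambda>h u. monomial 0 (Poly_Mapping.lookup (coeffs h) u) * \<phi> u"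
  \<comment> \<open>Cancellation can shrink the support of a sum, so all sums are taken over the
    union of both supports, where the additional terms vanish.\<close>
  have *: "lext \<phi> h = (\<Sum>u\<in>?K. ?t h u)" if "supp h \<subseteq> ?K" for h
    unfolding lext_def using that
    by (intro sum.mono_neutral_left) (auto simp: in_keys_iff)
  have "lext \<phi> (f + g) = (\<Sum>u\<in>?K. ?t f u + ?t g u)"
    using *[OF supp_add]
    by (simp add: plus_laurent.rep_eq lookup_add monomial_add distrib_right)
  then show ?thesis
    by (simp add: * sum.distrib)
qed

lemma supp_lext: "supp (lext \<phi> f) \<subseteq> (\<Union>u\<in>supp f. supp (\<phi> u))"
proof -
  have "supp (monomial 0 c * \<phi> u) \<subseteq> supp (\<phi> u)" for c u
    using supp_mult[of "monomial 0 c" "\<phi> u"] by (auto simp: supp_monomial split: if_splits)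
  then show ?thesis
    unfolding lext_def using supp_sum by fastforce
qed

lemma laurent_eq_sum: "f = (\<Sum>u\<in>supp f. monomial u (Poly_Mapping.lookup (coeffs f) u))"
proof -
  have c: "coeffs (sum h I) = (\<Sum>i\<in>I. coeffs (h i))" for h :: "'c \<Rightarrow> ('a, 'b) laurent" and I
    by (induction I rule: infinite_finite_induct) (auto simp: plus_laurent.rep_eq zero_laurent.rep_eq)
  have "coeffs (\<Sum>u\<in>supp f. monomial u (Poly_Mapping.lookup (coeffs f) u)) = coeffs f"
    unfolding c
    by (intro poly_mapping_eqI)
       (auto simp: lookup_sum coeffs_monomial lookup_single when_def in_keys_iff)
  then show ?thesis
    by (metis coeffs_inject)
qed

text \<open>Additive statements need to be checked only on monomials. The set \<open>S\<close>
  records where the exponents lie; some identities are available for lattice exponents only.\<close>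

lemma laurent_induct [consumes 1, case_names zero add monomial]:
  assumes "supp f \<subseteq> S" and "P 0" and "\<And>g h. P g \<Longrightarrow> P h \<Longrightarrow> P (g + h)"
    and "\<And>u c. u \<in> S \<Longrightarrow> P (monomial u c)"
  shows "P f"
proof -
  have "P (\<Sum>u\<in>I. monomial u (c u))" if "finite I" "I \<subseteq> S" for I and c :: "'a \<Rightarrow> 'b"
    using that by (induction I) (auto intro: assms)
  from this[OF _ assms(1)] show ?thesis
    by (metis finite_keys laurent_eq_sum)
qed

section \<open>Pullback along linear maps, in particular along multiplication by q\<close>

lemma comorphism_lext: "comorphism h = lext (\<lambda>u. monomial (adjoint h u) 1)"
  by (simp add: fun_eq_iff comorphism_def lext_def monomial_mult)

lemma comorphism_0 [simp]: "comorphism h 0 = 0"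
  by (simp add: comorphism_lext)

lemma comorphism_add: "comorphism h (f + g) = comorphism h f + comorphism h g"
  by (simp add: comorphism_lext lext_add)

lemma comorphism_monomial: "comorphism h (monomial u c) = monomial (adjoint h u) c"
  by (simp add: comorphism_lext lext_monomial monomial_mult)

lemma supp_comorphism: "supp (comorphism h f) \<subseteq> adjoint h ` supp f"
  using supp_lext[of "\<lambda>u. monomial (adjoint h u) 1" f]
  by (auto simp: comorphism_lext supp_monomial)

lemma comorphism_1:
  assumes "linear h" shows "comorphism h 1 = 1"
proof -
  have "adjoint h 0 = 0" by (simp add: adjoint_linear assms linear_0)
  then show ?thesis using comorphism_monomial[of h 0 1] by simp
qed

lemma comorphism_mult:
  assumes "linear h"
  shows "comorphism h (f * g) = comorphism h f * comorphism h g"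
proof (induction f rule: laurent_induct[OF subset_UNIV])
  case (3 u c)
  show ?case
  proof (induction g rule: laurent_induct[OF subset_UNIV])
    case (3 v d)
    show ?case
      by (simp add: comorphism_monomial monomial_mult adjoint_linear assms linear_add)
  qed (auto simp: comorphism_add distrib_left)
qed (auto simp: comorphism_add distrib_right)

lemma adjoint_scaleR: "adjoint (\<lambda>v. c *\<^sub>R v) = (\<lambda>v::'v::euclidean_space. c *\<^sub>R v)"
  by (rule adjoint_unique) simp

abbreviation Frob :: "int \<Rightarrow> ('v::euclidean_space, 'k::field) laurent \<Rightarrow> ('v, 'k) laurent" where
  "Frob q \<equiv> comorphism (\<lambda>v. of_int q *\<^sub>R v)"

lemma Frob_monomial: "Frob q (monomial u c) = monomial (of_int q *\<^sub>R u) c"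
  by (simp add: comorphism_monomial adjoint_scaleR)

lemma Frob_mult: "Frob q (f * g) = Frob q f * Frob q g"
  by (rule comorphism_mult) (rule linear_scaleR)

lemma Frob_1 [simp]: "Frob q 1 = 1"
  by (rule comorphism_1) (rule linear_scaleR)

text \<open>Exponents range over all of M_R, so dividing them by \<open>q\<close> is defined and
  gives a left inverse.\<close>

lemma Frob_eq_0:
  assumes "q \<noteq> 0" "Frob q f = 0" shows "f = 0"
proof -
  have "comorphism (\<lambda>v. (1 / of_int q) *\<^sub>R v) (Frob q f) = f"
    by (induction f rule: laurent_induct[OF subset_UNIV])
       (use assms(1) in \<open>auto simp: comorphism_add comorphism_monomial adjoint_scaleR\<close>)
  then show ?thesis using assms(2) by simp
qed

lemma Frob_eq_0_iff: "q \<noteq> 0 \<Longrightarrow> Frob q f = 0 \<longleftrightarrow> f = 0"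
  using Frob_eq_0 by auto

lemma F_pullback_Fract:
  assumes "q \<noteq> 0" "b \<noteq> 0"
  shows "F_pullback q (Fract a b) = Fract (Frob q a) (Frob q b)"
  unfolding F_pullback_def
  by (rule fract_map_Fract) (use assms Frob_mult Frob_eq_0 in auto)

lemma comorphism_Frob:
  assumes "linear h" shows "comorphism h (Frob q f) = Frob q (comorphism h f)"
  by (induction f rule: laurent_induct[OF subset_UNIV])
     (auto simp: comorphism_add comorphism_monomial adjoint_scaleR linear_scale[OF adjoint_linear[OF assms]])

section \<open>Points of toric varieties\<close>

definition subring_of :: "'a::comm_ring_1 set \<Rightarrow> bool" where
  "subring_of C \<longleftrightarrow> 1 \<in> C \<and> (\<forall>a\<in>C. \<forall>b\<in>C. a + b \<in> C \<and> a * b \<in> C) \<and> (\<forall>a\<in>C. - a \<in> C)"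

text \<open>Ideals are plain subsets of a ring given by a type class, so that calculations use
  ordinary arithmetic; \<open>chart_spec_iff\<close> translates from the record-based prime
  ideals.\<close>

definition ideal_in :: "'a::comm_ring_1 set \<Rightarrow> 'a set \<Rightarrow> bool" where
  "ideal_in C I \<longleftrightarrow> I \<subseteq> C \<and> 0 \<in> I \<and> (\<forall>a\<in>I. \<forall>b\<in>I. a + b \<in> I) \<and> (\<forall>a\<in>C. \<forall>b\<in>I. a * b \<in> I)"

definition prime_in :: "'a::comm_ring_1 set \<Rightarrow> 'a set \<Rightarrow> bool" where
  "prime_in C P \<longleftrightarrow> ideal_in C P \<and> 1 \<notin> P \<and> (\<forall>a\<in>C. \<forall>b\<in>C. a * b \<in> P \<longrightarrow> a \<in> P \<or> b \<in> P)"

lemma subring_ofD: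
  assumes "subring_of C"
  shows "0 \<in> C" "1 \<in> C" "a \<in> C \<Longrightarrow> b \<in> C \<Longrightarrow> a + b \<in> C" "a \<in> C \<Longrightarrow> b \<in> C \<Longrightarrow> a * b \<in> C"
    "a \<in> C \<Longrightarrow> - a \<in> C"
proof -
  show "0 \<in> C"
    using assms unfolding subring_of_def by (metis add.right_inverse)
qed (use assms in \<open>auto simp: subring_of_def\<close>)

lemma ideal_inD:
  assumes "ideal_in C I"
  shows "I \<subseteq> C" "0 \<in> I" "a \<in> I \<Longrightarrow> b \<in> I \<Longrightarrow> a + b \<in> I" "a \<in> C \<Longrightarrow> b \<in> I \<Longrightarrow> a * b \<in> I"
  using assms by (auto simp: ideal_in_def)

text \<open>An ideal that is maximal among those containing \<open>I\<close> and disjoint from the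
  multiplicative set \<open>T\<close> is prime; Zorn's lemma supplies one.\<close>

lemma prime_avoiding:
  assumes C: "subring_of C" and I: "ideal_in C I"
    and T: "T \<subseteq> C" "1 \<in> T" "\<And>a b. a \<in> T \<Longrightarrow> b \<in> T \<Longrightarrow> a * b \<in> T" and IT: "I \<inter> T = {}"
  obtains P where "prime_in C P" "I \<subseteq> P" "P \<inter> T = {}"
proof -
  define A where "A = {J. ideal_in C J \<and> I \<subseteq> J \<and> J \<inter> T = {}}"
  have "\<exists>M\<in>A. \<forall>X\<in>A. M \<subseteq> X \<longrightarrow> X = M"
  proof (rule subset_Zorn_nonempty)
    show "A \<noteq> {}" using I IT by (auto simp: A_def)
    fix \<C> assume ne: "\<C> \<noteq> {}" and ch: "subset.chain A \<C>"
    have sub: "J \<in> A" if "J \<in> \<C>" for J using ch that by (auto simp: subset_chain_def)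
    have "a + b \<in> \<Union>\<C>" if ab: "a \<in> \<Union>\<C>" "b \<in> \<Union>\<C>" for a b
    proof -
      from ab obtain J1 J2 where J: "a \<in> J1" "J1 \<in> \<C>" "b \<in> J2" "J2 \<in> \<C>" by blast
      with ch have "J1 \<subseteq> J2 \<or> J2 \<subseteq> J1" by (auto simp: subset_chain_def)
      then show ?thesis using J sub unfolding A_def ideal_in_def by blast
    qed
    moreover have "a * b \<in> \<Union>\<C>" if "a \<in> C" "b \<in> \<Union>\<C>" for a b
      using that sub unfolding A_def ideal_in_def by blast
    moreover obtain J where "J \<in> \<C>" "J \<in> A" using ne sub by blast
    moreover from this have "I \<subseteq> \<Union>\<C>" "0 \<in> \<Union>\<C>" unfolding A_def ideal_in_def by auto
    moreover have "\<Union>\<C> \<subseteq> C" "\<Union>\<C> \<inter> T = {}" using sub unfolding A_def ideal_in_def by blast+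
    ultimately show "\<Union>\<C> \<in> A"
      unfolding A_def ideal_in_def by simp
  qed
  then obtain M where M: "M \<in> A" and max: "\<And>X. X \<in> A \<Longrightarrow> M \<subseteq> X \<Longrightarrow> X = M" by blast
  have MI: "ideal_in C M" "I \<subseteq> M" "M \<inter> T = {}" using M by (auto simp: A_def)
  \<comment> \<open>\<open>M + C a\<close> is an ideal that properly contains \<open>M\<close>, so
    by maximality it meets \<open>T\<close>.\<close>
  have meets: "\<exists>m\<in>M. \<exists>r\<in>C. m + r * a \<in> T" if a: "a \<in> C" "a \<notin> M" for a
  proof (rule ccontr)
    assume no: "\<not> ?thesis"
    let ?J = "{m + r * a | m r. m \<in> M \<and> r \<in> C}"
    have sub: "M \<subseteq> ?J"
    proof
      fix m assume "m \<in> M"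
      moreover have "m = m + 0 * a" by simp
      ultimately show "m \<in> ?J" using subring_ofD(1)[OF C] by blast
    qed
    have "ideal_in C ?J"
      unfolding ideal_in_def
    proof (intro conjI ballI)
      show "?J \<subseteq> C" using MI(1) a C by (auto simp: ideal_in_def intro!: subring_ofD)
      show "0 \<in> ?J" using sub ideal_inD(2)[OF MI(1)] by (rule subsetD)
    next
      fix x y assume "x \<in> ?J" "y \<in> ?J"
      then obtain m r m' r' where *: "x = m + r * a" "y = m' + r' * a" "m \<in> M" "m' \<in> M" "r \<in> C" "r' \<in> C"
        by blast
      have "x + y = (m + m') + (r + r') * a" by (simp add: * algebra_simps)
      moreover have "m + m' \<in> M" "r + r' \<in> C"
        using * MI(1) subring_ofD[OF C] by (auto simp: ideal_in_def)
      ultimately show "x + y \<in> ?J" by blast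
    next
      fix x y assume "x \<in> C" "y \<in> ?J"
      then obtain m r where *: "y = m + r * a" "m \<in> M" "r \<in> C" by blast
      have "x * y = x * m + (x * r) * a" by (simp add: * algebra_simps)
      moreover have "x * m \<in> M" "x * r \<in> C"
        using * \<open>x \<in> C\<close> MI(1) subring_ofD[OF C] by (auto simp: ideal_in_def)
      ultimately show "x * y \<in> ?J" by blast
    qed
    then have "?J = M"
      using no sub MI(2) by (intro max) (auto simp: A_def)
    moreover have "a \<in> ?J"
      by (intro CollectI exI[of _ 0] exI[of _ 1]) (use ideal_inD[OF MI(1)] subring_ofD[OF C] in auto)
    ultimately show False using a(2) by simp
  qed
  have "a \<in> M \<or> b \<in> M" if ab: "a \<in> C" "b \<in> C" "a * b \<in> M" for a b
  proof (rule ccontr)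
    assume "\<not> ?thesis"
    with meets ab obtain m r m' r' where *: "m \<in> M" "r \<in> C" "m + r * a \<in> T" "m' \<in> M" "r' \<in> C" "m' + r' * b \<in> T"
      by metis
    \<comment> \<open>The product of the two elements of \<open>T\<close> stays in \<open>T\<close>,
      yet each term of its expansion lies in \<open>M\<close>.\<close>
    have "(m + r * a) * (m' + r' * b) = (m' + r' * b) * m + ((r * a) * m' + (r * r') * (a * b))"
      by (simp add: algebra_simps)
    also have "\<dots> \<in> M"
    proof (intro ideal_inD(3)[OF MI(1)])
      show "(m' + r' * b) * m \<in> M" using * T(1) by (intro ideal_inD(4)[OF MI(1)]) auto
      show "(r * a) * m' \<in> M" using * ab by (intro ideal_inD(4)[OF MI(1)] subring_ofD(4)[OF C])
      show "(r * r') * (a * b) \<in> M" using * by (intro ideal_inD(4)[OF MI(1) _ ab(3)] subring_ofD(4)[OF C])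
    qed
    finally show False using T(3)[OF *(3,6)] MI(3) by blast
  qed
  then have "prime_in C M"
    using MI T(2) by (auto simp: prime_in_def)
  then show thesis using that MI by blast
qed

lemma prime_in_vimage:
  assumes "prime_in D P" "subring_of C" "\<phi> ` C \<subseteq> D" "\<phi> 0 = 0" "\<phi> 1 = 1"
    "\<And>a b. \<phi> (a + b) = \<phi> a + \<phi> b" "\<And>a b. \<phi> (a * b) = \<phi> a * \<phi> b"
  shows "prime_in C {f \<in> C. \<phi> f \<in> P}"
  using assms unfolding prime_in_def ideal_in_def by (auto simp: subring_ofD image_subset_iff)

lemma prime_in_zero: "subring_of C \<Longrightarrow> prime_in C {0::'a::idom}"
  by (auto simp: prime_in_def ideal_in_def subring_ofD)

section \<open>Coordinate rings of charts and their primes\<close>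

abbreviation chart :: "'v::euclidean_space set \<Rightarrow> 'v set \<Rightarrow> ('v, 'k::field) laurent set" where
  "chart N \<sigma> \<equiv> carrier (chart_ring N \<sigma>)"

lemma chart_def: "chart N \<sigma> = {f. supp f \<subseteq> dual_cone \<sigma> \<inter> dual_lattice N}"
  by (simp add: chart_ring_def)

lemma dual_lattice_add: "u \<in> dual_lattice N \<Longrightarrow> v \<in> dual_lattice N \<Longrightarrow> u + v \<in> dual_lattice N"
  by (auto simp: dual_lattice_def inner_add_left)

lemma dual_lattice_diff: "u \<in> dual_lattice N \<Longrightarrow> v \<in> dual_lattice N \<Longrightarrow> u - v \<in> dual_lattice N"
  by (auto simp: dual_lattice_def inner_diff_left)

lemma dual_lattice_add_iff: "u \<in> dual_lattice N \<Longrightarrow> u + v \<in> dual_lattice N \<longleftrightarrow> v \<in> dual_lattice N"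
  using dual_lattice_add[of u N v] dual_lattice_diff[of "u + v" N u] by auto

lemma dual_lattice_0 [simp]: "0 \<in> dual_lattice N"
  by (simp add: dual_lattice_def)

lemma dual_lattice_scaleR: "u \<in> dual_lattice N \<Longrightarrow> of_int c *\<^sub>R u \<in> dual_lattice N"
  by (auto simp: dual_lattice_def)

lemma subring_of_chart: "subring_of (chart N \<sigma> :: ('v::euclidean_space, 'k::field) laurent set)"
proof -
  have 1: "0 \<in> dual_cone \<sigma> \<inter> dual_lattice N"
    by (simp add: dual_cone_def)
  have 2: "u + v \<in> dual_cone \<sigma> \<inter> dual_lattice N"
    if "u \<in> dual_cone \<sigma> \<inter> dual_lattice N" "v \<in> dual_cone \<sigma> \<inter> dual_lattice N" for u v
    using that by (auto simp: dual_cone_def dual_lattice_add inner_add_left)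
  have "f * g \<in> chart N \<sigma>" if "f \<in> chart N \<sigma>" "g \<in> chart N \<sigma>" for f g :: "('v, 'k) laurent"
    using that supp_mult[of f g] 2 unfolding chart_def by blast
  moreover have "f + g \<in> chart N \<sigma>" if "f \<in> chart N \<sigma>" "g \<in> chart N \<sigma>" for f g :: "('v, 'k) laurent"
    using that supp_add[of f g] unfolding chart_def by blast
  ultimately show ?thesis
    using 1 by (auto simp: subring_of_def chart_def)
qed

lemma cring_chart_ring: "cring (chart_ring N \<sigma> :: ('v::euclidean_space, 'k::field) laurent ring)"
proof -
  note S = subring_ofD[OF subring_of_chart[of N \<sigma>]]
  have s: "monoid.mult (chart_ring N \<sigma> :: ('v, 'k) laurent ring) = (*)"
    "add (chart_ring N \<sigma> :: ('v, 'k) laurent ring) = (+)"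
    "one (chart_ring N \<sigma> :: ('v, 'k) laurent ring) = 1" "zero (chart_ring N \<sigma> :: ('v, 'k) laurent ring) = 0"
    by (simp_all add: chart_ring_def)
  show ?thesis
  proof (rule cringI)
    show "abelian_group (chart_ring N \<sigma> :: ('v, 'k) laurent ring)"
    proof (rule abelian_groupI; unfold s)
      fix x :: "('v, 'k) laurent" assume "x \<in> chart N \<sigma>"
      then show "\<exists>y\<in>chart N \<sigma>. y + x = 0" using S(5) by (intro bexI[of _ "- x"]) auto
    qed (auto intro: S simp: algebra_simps)
    show "comm_monoid (chart_ring N \<sigma> :: ('v, 'k) laurent ring)"
      by (rule comm_monoidI; unfold s) (auto intro: S simp: algebra_simps)
  qed (unfold s, auto simp: algebra_simps)
qed

lemma chart_spec_iff: "P \<in> chart_spec N \<sigma> \<longleftrightarrow> prime_in (chart N \<sigma>) P"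
proof -
  let ?R = "chart_ring N \<sigma> :: ('a, 'b) laurent ring"
  have s: "monoid.mult ?R = (*)" "add ?R = (+)" "one ?R = 1" "zero ?R = 0"
    by (simp_all add: chart_ring_def)
  interpret cring ?R by (rule cring_chart_ring)
  note S = subring_ofD[OF subring_of_chart[of N \<sigma>]]
  show ?thesis
  proof
    assume "P \<in> chart_spec N \<sigma>"
    then interpret primeideal P ?R by (simp add: chart_spec_def)
    have "1 \<notin> P"
      using one_imp_carrier I_notcarr s by metis
    then show "prime_in (chart N \<sigma>) P"
      using a_subset zero_closed a_closed I_l_closed I_prime
      unfolding prime_in_def ideal_in_def s by auto
  next
    assume P: "prime_in (chart N \<sigma>) P"
    \<comment> \<open>Closure under negation is recovered from multiplication by -1, which lies in
      the subring.\<close>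
    have "- b \<in> P" if "b \<in> P" for b
    proof -
      have "(- 1) * b \<in> P"
        using P that S(2,5) unfolding prime_in_def ideal_in_def by blast
      then show ?thesis by simp
    qed
    moreover have "\<ominus>\<^bsub>?R\<^esub> b = - b" if "b \<in> chart N \<sigma>" for b
      using that S(5)[OF that] by (intro minus_equality) (auto simp: s)
    moreover have PC: "P \<subseteq> chart N \<sigma>"
      using P by (auto simp: prime_in_def ideal_in_def)
    ultimately have "subgroup P (add_monoid ?R)"
      using P unfolding prime_in_def ideal_in_def
      by (intro add.subgroupI) (auto simp: s a_inv_def[symmetric] subset_iff)
    moreover have "x * a \<in> P \<and> a * x \<in> P" if "a \<in> P" "x \<in> chart N \<sigma>" for a x
      using P that by (auto simp: prime_in_def ideal_in_def mult.commute[of a x])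
    ultimately have "ideal P ?R"
      by (intro idealI) (auto simp: s ring_axioms)
    then have "primeideal P ?R"
      using P S(2) by (intro primeidealI cring_chart_ring) (auto simp: s prime_in_def)
    then show "P \<in> chart_spec N \<sigma>" by (simp add: chart_spec_def)
  qed
qed

section \<open>Splittings from maps of group algebras\<close>

lemma Frob_chart:
  assumes "q \<ge> 0" "f \<in> chart N \<sigma>" shows "Frob q f \<in> chart N \<sigma>"
proof -
  have "of_int q *\<^sub>R u \<in> dual_cone \<sigma> \<inter> dual_lattice N" if "u \<in> dual_cone \<sigma> \<inter> dual_lattice N" for u
    using that assms(1) by (auto simp: dual_cone_def dual_lattice_scaleR)
  then show ?thesis
    using assms(2) supp_comorphism[of "\<lambda>v. of_int q *\<^sub>R v" f] unfolding chart_def adjoint_scaleR by blast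
qed

text \<open>Within a chart an open set consists of the primes that fail to contain some set
  \<open>E\<close>; this property passes to smaller primes.\<close>

lemma toric_open_generization:
  assumes "toric_open N \<Sigma> U" "\<sigma> \<in> \<Sigma>" "P \<in> chart_spec N \<sigma>" "local_ring N \<sigma> P \<in> U"
    "P0 \<in> chart_spec N \<sigma>" "P0 \<subseteq> P"
  shows "local_ring N \<sigma> P0 \<in> U"
  using assms unfolding toric_open_def by (meson order_trans)

text \<open>Multiplication by \<open>q\<close> maps the cone into itself, so \<open>F\<close> sends
  the point of \<open>P\<close> to that of its contraction in the same chart.\<close>

lemma F_vimage_local_ring:
  assumes "q > 0" "\<sigma> \<in> \<Sigma>" "\<And>x. x \<in> \<sigma> \<Longrightarrow> of_int q *\<^sub>R x \<in> \<sigma>" "P \<in> chart_spec N \<sigma>"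
    "local_ring N \<sigma> {f \<in> chart N \<sigma>. Frob q f \<in> P} \<in> U"
  shows "local_ring N \<sigma> P \<in> F_vimage q N \<Sigma> U"
proof -
  have "(local_ring N \<sigma> P, local_ring N \<sigma> {f \<in> chart N \<sigma>. Frob q f \<in> P}) \<in>
    toric_morphism (\<lambda>v. of_int q *\<^sub>R v) N \<Sigma> N \<Sigma>"
    unfolding toric_morphism_def using assms(2-4) by blast
  then show ?thesis using assms(5) by (auto simp: F_vimage_def)
qed

text \<open>
  The conductor \<open>I = {b. b g \<in> C}\<close> of a section \<open>g\<close> meets \<open>F\<^sup>*(C - P)\<close>: otherwise a prime containing
  \<open>I\<close> and avoiding \<open>F\<^sup>*(C - P)\<close> contracts to a generization of \<open>P\<close>, which lies in \<open>U\<close>, so that \<open>g\<close>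
  would be regular there.
\<close>

lemma sections_F_vimage_eq_Fract:
  fixes N :: "'v::euclidean_space set" and P :: "('v, 'k::field) laurent set"
  assumes q: "q > 0" and \<sigma>: "\<sigma> \<in> \<Sigma>" "\<And>x. x \<in> \<sigma> \<Longrightarrow> of_int q *\<^sub>R x \<in> \<sigma>"
    and U: "toric_open N \<Sigma> U" and P: "P \<in> chart_spec N \<sigma>" "local_ring N \<sigma> P \<in> U"
    and g: "g \<in> sections (F_vimage q N \<Sigma> U)"
  obtains a h where "a \<in> chart N \<sigma>" "h \<in> chart N \<sigma>" "h \<notin> P" "h \<noteq> 0" "g = Fract a (Frob q h)"
proof -
  define C :: "('v, 'k) laurent set" where "C = chart N \<sigma>"
  have C: "subring_of C" unfolding C_def by (rule subring_of_chart)
  note CD = subring_ofD[OF C]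
  have PC: "prime_in C P" using P(1) by (simp add: chart_spec_iff C_def)
  then have PI: "ideal_in C P" by (simp add: prime_in_def)
  define I where "I = {b \<in> C. \<exists>a\<in>C. g * Fract b 1 = Fract a 1}"
  define T where "T = Frob q ` (C - P)"
  have "ideal_in C I"
    unfolding ideal_in_def
  proof (intro conjI ballI)
    show "I \<subseteq> C" by (auto simp: I_def)
    show "0 \<in> I" using CD(1) by (auto simp: I_def Zero_fract_def[symmetric] intro!: bexI[of _ 0])
  next
    fix x y assume "x \<in> I" "y \<in> I"
    then obtain a b where *: "x \<in> C" "y \<in> C" "a \<in> C" "b \<in> C" "g * Fract x 1 = Fract a 1" "g * Fract y 1 = Fract b 1"
      by (auto simp: I_def)
    have "g * Fract (x + y) 1 = g * Fract x 1 + g * Fract y 1"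
      by (simp add: distrib_left[symmetric])
    also have "\<dots> = Fract (a + b) 1" by (simp add: *)
    finally show "x + y \<in> I" using * CD(3) by (auto simp: I_def)
  next
    fix x y assume "x \<in> C" "y \<in> I"
    then obtain b where *: "x \<in> C" "y \<in> C" "b \<in> C" "g * Fract y 1 = Fract b 1"
      by (auto simp: I_def)
    have "g * Fract (x * y) 1 = Fract x 1 * (g * Fract y 1)"
      using mult_fract[of x 1 y 1] by (simp del: mult_fract add: mult.left_commute[of g])
    also have "\<dots> = Fract (x * b) 1" by (simp add: *)
    finally show "x * y \<in> I" using * CD(4) by (auto simp: I_def)
  qed
  have "I \<inter> T \<noteq> {}"
  proof
    assume "I \<inter> T = {}"
    moreover have "T \<subseteq> C" using q Frob_chart[of q _ N \<sigma>] by (auto simp: T_def C_def)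
    moreover have "1 \<in> T" using PC CD(2) by (force simp: T_def prime_in_def image_iff)
    moreover have "a * b \<in> T" if ab: "a \<in> T" "b \<in> T" for a b
    proof -
      obtain x y where *: "a = Frob q x" "b = Frob q y" "x \<in> C" "x \<notin> P" "y \<in> C" "y \<notin> P"
        using ab unfolding T_def by blast
      then have "x * y \<in> C - P" using PC CD(4) unfolding prime_in_def by blast
      then show ?thesis unfolding T_def *(1,2) Frob_mult[symmetric] by (rule imageI)
    qed
    ultimately obtain P' where P': "prime_in C P'" "I \<subseteq> P'" "P' \<inter> T = {}"
      using prime_avoiding[OF C \<open>ideal_in C I\<close>] by metis
    define P0 where "P0 = {f \<in> C. Frob q f \<in> P'}"
    have "prime_in C P0"
      unfolding P0_def using q Frob_chart[of q _ N \<sigma>]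
      by (intro prime_in_vimage[OF P'(1) C]) (auto simp: C_def Frob_mult comorphism_add)
    \<comment> \<open>F* maps elements of \<open>C\<close> outside \<open>P\<close> into
      \<open>T\<close>, which \<open>P'\<close> avoids; so the contraction stays inside
      \<open>P\<close>.\<close>
    moreover have "P0 \<subseteq> P" using P'(3) by (auto simp: P0_def T_def)
    ultimately have "local_ring N \<sigma> P0 \<in> U"
      using toric_open_generization[OF U \<sigma>(1) P] by (simp add: chart_spec_iff C_def)
    then have "local_ring N \<sigma> P' \<in> F_vimage q N \<Sigma> U"
      using F_vimage_local_ring[OF q \<sigma>, of P' N U] P'(1) by (auto simp: chart_spec_iff C_def P0_def)
    then have "g \<in> local_ring N \<sigma> P'" using g by (auto simp: sections_def)
    then obtain a b where ab: "g = Fract a b" "a \<in> C" "b \<in> C" "b \<notin> P'"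
      by (auto simp: local_ring_def C_def)
    have "b \<noteq> 0" using ab(4) P'(1) by (auto simp: prime_in_def ideal_in_def)
    \<comment> \<open>The denominator carries \<open>g\<close> into \<open>C\<close>, so it belongs
      to the conductor and hence to \<open>P'\<close>, contrary to its choice.\<close>
    then have "b \<in> I" using ab by (auto simp: I_def eq_fract)
    then show False using ab P'(2) by auto
  qed
  then obtain a h where *: "h \<in> C" "h \<notin> P" "a \<in> C" "g * Fract (Frob q h) 1 = Fract a 1"
    by (auto simp: I_def T_def)
  have "h \<noteq> 0" using *(2) ideal_inD(2)[OF PI] by auto
  then have "Frob q h \<noteq> 0" using Frob_eq_0[of q h] q by auto
  have "g = g * Fract (Frob q h) 1 * Fract 1 (Frob q h)"
    using \<open>Frob q h \<noteq> 0\<close> by (simp add: mult.assoc One_fract_def eq_fract)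
  also have "\<dots> = Fract a (Frob q h)" by (simp add: *)
  finally show thesis using that * \<open>h \<noteq> 0\<close> by (auto simp: C_def)
qed

section \<open>Extension of maps of the group algebra to fractions\<close>

definition lattice_algebra :: "'v::euclidean_space set \<Rightarrow> ('v, 'k::field) laurent set" where
  "lattice_algebra N = {f. supp f \<subseteq> dual_lattice N}"

lemma chart_subset_lattice_algebra: "chart N \<sigma> \<subseteq> lattice_algebra N"
  by (auto simp: chart_def lattice_algebra_def)

lemma subring_of_lattice_algebra: "subring_of (lattice_algebra N :: ('v::euclidean_space, 'k::field) laurent set)"
proof -
  \<comment> \<open>The dual cone of the empty set is the whole space, so the lattice algebra is a
    chart ring as well.\<close>
  have "lattice_algebra N = (chart N {} :: ('v, 'k) laurent set)"
    by (simp add: chart_def lattice_algebra_def dual_cone_def)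
  then show ?thesis by (simp add: subring_of_chart)
qed

text \<open>Numerators and denominators have lattice exponents because linearity over F* is assumed
  of \<open>p\<close> only there.\<close>

definition fract_extension ::
  "int \<Rightarrow> 'v::euclidean_space set \<Rightarrow> (('v, 'k::field) laurent \<Rightarrow> ('v, 'k) laurent) \<Rightarrow>
   ('v, 'k) laurent fract \<Rightarrow> ('v, 'k) laurent fract" where
  "fract_extension q N p g =
     (THE y. \<exists>a\<in>lattice_algebra N. \<exists>h\<in>lattice_algebra N. h \<noteq> 0 \<and> g = Fract a (Frob q h) \<and> y = Fract (p a) h)"

text \<open>On the torus this describes the homomorphisms from F_* O to O: a function
  \<open>f\<close> acts on the source through F* f.\<close>

definition Frob_inverse_linear ::
  "int \<Rightarrow> 'v::euclidean_space set \<Rightarrow> (('v, 'k::field) laurent \<Rightarrow> ('v, 'k) laurent) \<Rightarrow> bool" where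
  "Frob_inverse_linear q N p \<longleftrightarrow>
     (\<forall>f g. p (f + g) = p f + p g) \<and>
     (\<forall>f\<in>lattice_algebra N. \<forall>g\<in>lattice_algebra N. p (Frob q f * g) = f * p g)"

text \<open>The value is independent of the representation: applying \<open>p\<close> to the
  cross-multiplied equation \<open>F* h' a = F* h a'\<close> gives
  \<open>h' p a = h p a'\<close>.\<close>

lemma fract_extension_Fract:
  assumes "q \<noteq> 0" "Frob_inverse_linear q N p"
    "a \<in> lattice_algebra N" "h \<in> lattice_algebra N" "h \<noteq> 0"
  shows "fract_extension q N p (Fract a (Frob q h)) = Fract (p a) h"
  unfolding fract_extension_def
proof (rule the_equality)
  show "\<exists>a'\<in>lattice_algebra N. \<exists>h'\<in>lattice_algebra N.
      h' \<noteq> 0 \<and> Fract a (Frob q h) = Fract a' (Frob q h') \<and> Fract (p a) h = Fract (p a') h'"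
    using assms by blast
next
  fix y
  assume "\<exists>a'\<in>lattice_algebra N. \<exists>h'\<in>lattice_algebra N.
      h' \<noteq> 0 \<and> Fract a (Frob q h) = Fract a' (Frob q h') \<and> y = Fract (p a') h'"
  then obtain a' h' where *: "a' \<in> lattice_algebra N" "h' \<in> lattice_algebra N" "h' \<noteq> 0"
    "Fract a (Frob q h) = Fract a' (Frob q h')" "y = Fract (p a') h'" by blast
  have "Frob q h \<noteq> 0" "Frob q h' \<noteq> 0"
    using Frob_eq_0 assms(1,5) *(3) by blast+
  then have "Frob q h' * a = Frob q h * a'"
    using *(4) by (simp add: eq_fract mult.commute)
  then have "h' * p a = h * p a'"
    using assms(2-4) *(1,2) unfolding Frob_inverse_linear_def by metis
  then show "y = Fract (p a) h"
    using *(3,5) assms(5) by (simp add: eq_fract mult.commute)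
qed

text \<open>One map of the function field serves all open sets, which makes it commute with
  restriction. Regularity of the image at a point needs a denominator F* h with \<open>h\<close>
  invertible there; the algebraic identities can be checked with any representation as a
  fraction.\<close>

proposition is_splitting_fract_extension:
  fixes N :: "'v::euclidean_space set" and p :: "('v, 'k::field) laurent \<Rightarrow> ('v, 'k) laurent"
  assumes q: "q > 0" and \<Sigma>: "\<And>\<sigma> x. \<sigma> \<in> \<Sigma> \<Longrightarrow> x \<in> \<sigma> \<Longrightarrow> of_int q *\<^sub>R x \<in> \<sigma>"
    and p: "Frob_inverse_linear q N p" and p1: "p 1 = 1"
    and pC: "\<And>\<sigma> f. \<sigma> \<in> \<Sigma> \<Longrightarrow> f \<in> chart N \<sigma> \<Longrightarrow> p f \<in> chart N \<sigma>"
  shows "is_splitting q N \<Sigma> (\<lambda>U. fract_extension q N p)"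
proof -
  let ?\<pi> = "fract_extension q N p"
  have pD: "p (f + g) = p f + p g" for f g
    using p by (auto simp: Frob_inverse_linear_def)
  have pF: "p (Frob q f * g) = f * p g" if "f \<in> lattice_algebra N" "g \<in> lattice_algebra N" for f g
    using p that by (auto simp: Frob_inverse_linear_def)
  have ne: "Frob q h \<noteq> 0" if "h \<noteq> 0" for h :: "('v, 'k) laurent"
    using Frob_eq_0[of q h] q that by auto
  have qn: "q \<noteq> 0" using q by simp
  note \<pi> = fract_extension_Fract[OF qn p]
  note L = subring_ofD[OF subring_of_lattice_algebra[of N]]
  have FL: "Frob q f \<in> lattice_algebra N" if "f \<in> lattice_algebra N" for f :: "('v, 'k) laurent"
    using Frob_chart[of q f N "{}"] that q by (auto simp: chart_def lattice_algebra_def dual_cone_def)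
  show ?thesis
    unfolding is_splitting_def
  proof (intro allI impI, elim conjE)
    fix U :: "('v, 'k) laurent fract set set"
    assume U: "toric_open N \<Sigma> U" "U \<noteq> {}"
    have pt: "\<exists>\<sigma> P. \<sigma> \<in> \<Sigma> \<and> P \<in> chart_spec N \<sigma> \<and> x = local_ring N \<sigma> P" if "x \<in> U" for x
      using that U(1) unfolding toric_open_def toric_points_def by blast
    have repr: "\<exists>a h. a \<in> chart N \<sigma> \<and> h \<in> chart N \<sigma> \<and> h \<notin> P \<and> h \<noteq> 0 \<and> g = Fract a (Frob q h)"
      if "\<sigma> \<in> \<Sigma>" "P \<in> chart_spec N \<sigma>" "local_ring N \<sigma> P \<in> U" "g \<in> sections (F_vimage q N \<Sigma> U)" for \<sigma> P g
      using sections_F_vimage_eq_Fract[OF q that(1) \<Sigma>[OF that(1)] U(1) that(2-4)] by metis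
    have loc: "?\<pi> g \<in> sections U" if g: "g \<in> sections (F_vimage q N \<Sigma> U)" for g
      unfolding sections_def
    proof
      fix x assume "x \<in> U"
      then obtain \<sigma> P where *: "\<sigma> \<in> \<Sigma>" "P \<in> chart_spec N \<sigma>" "x = local_ring N \<sigma> P"
        using pt by blast
      then obtain a h where ah: "a \<in> chart N \<sigma>" "h \<in> chart N \<sigma>" "h \<notin> P" "h \<noteq> 0" "g = Fract a (Frob q h)"
        using repr g \<open>x \<in> U\<close> by metis
      then have "?\<pi> g = Fract (p a) h"
        using \<pi> chart_subset_lattice_algebra by blast
      then show "?\<pi> g \<in> x" using ah pC[OF *(1)] by (auto simp: *(3) local_ring_def)
    qed
    \<comment> \<open>Since \<open>U\<close> is nonempty it has a point, and the representation at
      this one point is used for the identities.\<close>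
    obtain \<sigma> P where s: "\<sigma> \<in> \<Sigma>" "P \<in> chart_spec N \<sigma>" "local_ring N \<sigma> P \<in> U"
      using U(2) pt by blast
    have glob: "\<exists>a h. a \<in> lattice_algebra N \<and> h \<in> lattice_algebra N \<and> h \<noteq> 0 \<and> g = Fract a (Frob q h)"
      if "g \<in> sections (F_vimage q N \<Sigma> U)" for g
      using repr[OF s that] chart_subset_lattice_algebra by blast
    have glob': "\<exists>a h. a \<in> lattice_algebra N \<and> h \<in> lattice_algebra N \<and> h \<noteq> 0 \<and> f = Fract a h"
      if "f \<in> sections U" for f
    proof -
      have "f \<in> local_ring N \<sigma> P" using that s(3) by (auto simp: sections_def)
      then obtain a b where "f = Fract a b" "a \<in> chart N \<sigma>" "b \<in> chart N \<sigma>" "b \<notin> P"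
        by (auto simp: local_ring_def)
      moreover from this have "b \<noteq> 0"
        using s(2) by (auto simp: chart_spec_iff prime_in_def ideal_in_def)
      ultimately show ?thesis using chart_subset_lattice_algebra by blast
    qed
    show "(\<forall>g\<in>sections (F_vimage q N \<Sigma> U). ?\<pi> g \<in> sections U) \<and>
      (\<forall>g\<in>sections (F_vimage q N \<Sigma> U). \<forall>g'\<in>sections (F_vimage q N \<Sigma> U). ?\<pi> (g + g') = ?\<pi> g + ?\<pi> g') \<and>
      (\<forall>f\<in>sections U. \<forall>g\<in>sections (F_vimage q N \<Sigma> U). ?\<pi> (F_pullback q f * g) = f * ?\<pi> g) \<and>
      (\<forall>V. toric_open N \<Sigma> V \<and> V \<noteq> {} \<and> V \<subseteq> U \<longrightarrow> (\<forall>g\<in>sections (F_vimage q N \<Sigma> U). ?\<pi> g = ?\<pi> g)) \<and>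
      (\<forall>f\<in>sections U. ?\<pi> (F_pullback q f) = f)"
    proof (intro conjI ballI)
      fix g g' assume "g \<in> sections (F_vimage q N \<Sigma> U)" "g' \<in> sections (F_vimage q N \<Sigma> U)"
      then obtain a h a' h' where *: "a \<in> lattice_algebra N" "h \<in> lattice_algebra N" "h \<noteq> 0" "g = Fract a (Frob q h)"
        "a' \<in> lattice_algebra N" "h' \<in> lattice_algebra N" "h' \<noteq> 0" "g' = Fract a' (Frob q h')"
        using glob by metis
      have "g + g' = Fract (Frob q h' * a + Frob q h * a') (Frob q (h * h'))"
        using * ne by (simp add: Frob_mult mult.commute)
      also have "?\<pi> \<dots> = Fract (h' * p a + h * p a') (h * h')"
        using * by (subst \<pi>) (auto simp: pD pF intro!: L FL)
      finally show "?\<pi> (g + g') = ?\<pi> g + ?\<pi> g'"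
        using * by (simp add: \<pi> mult.commute)
    next
      fix f g assume "f \<in> sections U" "g \<in> sections (F_vimage q N \<Sigma> U)"
      then obtain a h c d where *: "a \<in> lattice_algebra N" "h \<in> lattice_algebra N" "h \<noteq> 0" "g = Fract a (Frob q h)"
        "c \<in> lattice_algebra N" "d \<in> lattice_algebra N" "d \<noteq> 0" "f = Fract c d"
        using glob glob' by metis
      have "F_pullback q f * g = Fract (Frob q c * a) (Frob q (d * h))"
        using * qn by (simp add: F_pullback_Fract Frob_mult)
      also have "?\<pi> \<dots> = Fract (c * p a) (d * h)"
        using * by (subst \<pi>) (auto simp: pF intro!: L FL)
      finally show "?\<pi> (F_pullback q f * g) = f * ?\<pi> g"
        using * by (simp add: \<pi>)
    next
      fix f assume "f \<in> sections U"
      then obtain c d where *: "c \<in> lattice_algebra N" "d \<in> lattice_algebra N" "d \<noteq> 0" "f = Fract c d"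
        using glob' by metis
      have "p (Frob q c) = c"
        using pF[OF *(1) L(2)] p1 by simp
      then show "?\<pi> (F_pullback q f) = f"
        using * qn by (simp add: F_pullback_Fract \<pi> FL)
    qed (use loc in auto)
  qed
qed

section \<open>Compatibility with the diagonal\<close>

text \<open>Pairing with vectors that have one zero component separates the two conditions.\<close>

lemma dual_lattice_Times:
  assumes "0 \<in> N" "0 \<in> N'" shows "dual_lattice (N \<times> N') = dual_lattice N \<times> dual_lattice N'"
proof
  show "dual_lattice (N \<times> N') \<subseteq> dual_lattice N \<times> dual_lattice N'"
  proof
    fix w assume w: "w \<in> dual_lattice (N \<times> N')"
    obtain u u' where [simp]: "w = (u, u')" by (cases w)
    have *: "u \<bullet> v + u' \<bullet> v' \<in> \<int>" if "v \<in> N" "v' \<in> N'" for v v'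
      using w that unfolding dual_lattice_def by force
    show "w \<in> dual_lattice N \<times> dual_lattice N'"
      using *[OF _ assms(2)] *[OF assms(1)] by (auto simp: dual_lattice_def)
  qed
qed (auto simp: dual_lattice_def)

lemma dual_cone_Times:
  assumes "0 \<in> \<sigma>" "0 \<in> \<tau>" shows "dual_cone (\<sigma> \<times> \<tau>) = dual_cone \<sigma> \<times> dual_cone \<tau>"
proof
  show "dual_cone (\<sigma> \<times> \<tau>) \<subseteq> dual_cone \<sigma> \<times> dual_cone \<tau>"
  proof
    fix w assume w: "w \<in> dual_cone (\<sigma> \<times> \<tau>)"
    obtain u u' where [simp]: "w = (u, u')" by (cases w)
    have *: "0 \<le> u \<bullet> v + u' \<bullet> v'" if "v \<in> \<sigma>" "v' \<in> \<tau>" for v v'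
      using w that unfolding dual_cone_def by force
    show "w \<in> dual_cone \<sigma> \<times> dual_cone \<tau>"
      using *[OF _ assms(2)] *[OF assms(1)] by (auto simp: dual_cone_def)
  qed
qed (auto simp: dual_cone_def)

section \<open>Restriction to the diagonal\<close>

abbreviation diag_restrict :: "('v::euclidean_space \<times> 'v, 'k::field) laurent \<Rightarrow> ('v, 'k) laurent" where
  "diag_restrict \<equiv> comorphism (\<lambda>v. (v, v))"

text \<open>Restriction to the diagonal thus sends \<open>x^(a, b)\<close> to
  \<open>x^(a + b)\<close>, and compatibility becomes a question about sums of exponents.\<close>

lemma adjoint_diag: "adjoint (\<lambda>v::'v::euclidean_space. (v, v)) = (\<lambda>u. fst u + snd u)"
  by (rule adjoint_unique) (simp add: inner_prod_def inner_add_right)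

lemma linear_diag: "linear (\<lambda>v::'v::euclidean_space. (v, v))"
  by (simp add: linear_iff)

lemma diag_restrict_chart:
  assumes "f \<in> chart (N \<times> N) \<tau>" "(\<lambda>v. (v, v)) ` \<sigma> \<subseteq> \<tau>"
  shows "diag_restrict f \<in> chart N \<sigma>"
proof -
  have "fst u + snd u \<in> dual_cone \<sigma> \<inter> dual_lattice N" if u: "u \<in> dual_cone \<tau> \<inter> dual_lattice (N \<times> N)" for u
  proof -
    have eq: "(fst u + snd u) \<bullet> v = u \<bullet> (v, v)" for v
      by (simp add: inner_prod_def inner_add_left)
    show ?thesis
      using u assms(2) by (auto simp: dual_cone_def dual_lattice_def eq)
  qed
  then show ?thesis
    using assms(1) supp_comorphism[of "\<lambda>v. (v, v)" f] unfolding chart_def adjoint_diag by blast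
qed

lemma prime_in_diag_restrict:
  assumes "(\<lambda>v. (v, v)) ` \<sigma> \<subseteq> \<tau>" "prime_in (chart N \<sigma>) P"
  shows "prime_in (chart (N \<times> N) \<tau>) {f \<in> chart (N \<times> N) \<tau>. diag_restrict f \<in> P}"
  by (rule prime_in_vimage[OF assms(2) subring_of_chart])
     (use assms(1) in \<open>auto simp: diag_restrict_chart comorphism_add comorphism_mult comorphism_1 linear_diag\<close>)

text \<open>
  A section of the ideal sheaf of the diagonal vanishes at the generic point of the diagonal, which
  is a generization of all its other points and is fixed by the morphism \<open>F\<close>.
\<close>

proposition compatible_diagonal:
  fixes N :: "'v::euclidean_space set" and p :: "('v \<times> 'v, 'k::field) laurent \<Rightarrow> ('v \<times> 'v, 'k) laurent"
  assumes q: "q > 0" and \<Sigma>: "\<And>\<tau> x. \<tau> \<in> product_fan \<Sigma> \<Sigma> \<Longrightarrow> x \<in> \<tau> \<Longrightarrow> of_int q *\<^sub>R x \<in> \<tau>"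
    and p: "Frob_inverse_linear q (N \<times> N) p"
    and split: "is_splitting q (N \<times> N) (product_fan \<Sigma> \<Sigma>) (\<lambda>U. fract_extension q (N \<times> N) p)"
    and pC: "\<And>\<tau> f. \<tau> \<in> product_fan \<Sigma> \<Sigma> \<Longrightarrow> f \<in> chart (N \<times> N) \<tau> \<Longrightarrow> p f \<in> chart (N \<times> N) \<tau>"
    and p\<delta>: "\<And>f. f \<in> lattice_algebra (N \<times> N) \<Longrightarrow> diag_restrict f = 0 \<Longrightarrow> diag_restrict (p f) = 0"
  shows "compatible q (N \<times> N) (product_fan \<Sigma> \<Sigma>) (diagonal N \<Sigma>) (\<lambda>U. fract_extension q (N \<times> N) p)"
  unfolding compatible_def
proof (intro allI impI image_subsetI, elim conjE)
  let ?N = "N \<times> N" and ?\<Sigma> = "product_fan \<Sigma> \<Sigma>"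
  let ?\<pi> = "fract_extension q ?N p"
  fix U :: "('v \<times> 'v, 'k) laurent fract set set" and g
  assume U: "toric_open ?N ?\<Sigma> U" "U \<noteq> {}"
    and g: "g \<in> ideal_sections (diagonal N \<Sigma>) (F_vimage q ?N ?\<Sigma> U)"
  then have gs: "g \<in> sections (F_vimage q ?N ?\<Sigma> U)" by (simp add: ideal_sections_def)
  then have "?\<pi> g \<in> sections U"
    using split[unfolded is_splitting_def, THEN spec[of _ U]] U by simp
  moreover have "?\<pi> g \<in> maximal_ideal z" if z: "z \<in> diagonal N \<Sigma>" "z \<in> U" for z
  proof -
    from z(1) obtain \<sigma> \<tau> P where *: "\<sigma> \<in> \<Sigma>" "\<tau> \<in> ?\<Sigma>" "(\<lambda>v. (v, v)) ` \<sigma> \<subseteq> \<tau>" "P \<in> chart_spec N \<sigma>"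
      "z = local_ring ?N \<tau> {f \<in> chart ?N \<tau>. diag_restrict f \<in> P}"
      unfolding diagonal_def toric_morphism_def by blast
    define C :: "('v \<times> 'v, 'k) laurent set" where "C = chart ?N \<tau>"
    define Q where "Q = {f \<in> C. diag_restrict f \<in> P}"
    define Q0 where "Q0 = {f \<in> C. diag_restrict f \<in> {0}}"
    have P: "prime_in (chart N \<sigma>) P" using *(4) by (simp add: chart_spec_iff)
    then have Q: "prime_in C Q"
      unfolding Q_def C_def by (rule prime_in_diag_restrict[OF *(3)])
    have zero: "prime_in (chart N \<sigma>) {0}" by (intro prime_in_zero subring_of_chart)
    then have Q0: "prime_in C Q0"
      unfolding Q0_def C_def by (rule prime_in_diag_restrict[OF *(3)])
    have sub: "Q0 \<subseteq> Q"
      using P by (auto simp: Q_def Q0_def prime_in_def ideal_in_def)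
    have Qs: "Q \<in> chart_spec ?N \<tau>" "Q0 \<in> chart_spec ?N \<tau>"
      using Q Q0 unfolding chart_spec_iff C_def by blast+
    have zQ: "z = local_ring ?N \<tau> Q" unfolding *(5) Q_def C_def ..
    have "local_ring ?N \<tau> Q0 \<in> U"
      by (rule toric_open_generization[OF U(1) *(2) Qs(1) z(2)[unfolded zQ] Qs(2) sub])
    \<comment> \<open>\<open>F\<close> fixes the generic point of the diagonal because F* commutes
      with restriction to the diagonal and is injective.\<close>
    moreover have "{f \<in> chart ?N \<tau>. Frob q f \<in> Q0} = Q0"
      using Frob_chart[of q _ ?N \<tau>] q
      by (auto simp: Q0_def C_def comorphism_Frob[OF linear_diag] Frob_eq_0_iff)
    ultimately have "local_ring ?N \<tau> Q0 \<in> F_vimage q ?N ?\<Sigma> U"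
      by (intro F_vimage_local_ring[OF q *(2) \<Sigma>[OF *(2)] Qs(2)]) simp_all
    moreover have "local_ring ?N \<tau> Q0 \<in> diagonal N \<Sigma>"
      unfolding diagonal_def
    proof (rule RangeI)
      show "(local_ring N \<sigma> {0}, local_ring ?N \<tau> Q0) \<in> toric_morphism (\<lambda>v. (v, v)) N \<Sigma> ?N ?\<Sigma>"
        using *(1-3) zero[folded chart_spec_iff] unfolding toric_morphism_def Q0_def C_def by blast
    qed
    ultimately have gm: "g \<in> maximal_ideal (local_ring ?N \<tau> Q0)"
      using g by (auto simp: ideal_sections_def)
    from sections_F_vimage_eq_Fract[OF q *(2) \<Sigma>[OF *(2)] U(1) Qs(1) z(2)[unfolded zQ] gs]
    obtain a h where ah: "a \<in> C" "h \<in> C" "h \<notin> Q" "h \<noteq> 0" "g = Fract a (Frob q h)"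
      unfolding C_def by metis
    have Fh: "Frob q h \<noteq> 0" using Frob_eq_0[of q h] q ah(4) by auto
    \<comment> \<open>Otherwise \<open>F* h / a\<close> would be an inverse of \<open>g\<close> in
      the local ring of the generic point.\<close>
    have "a \<in> Q0"
    proof (rule ccontr)
      assume a: "a \<notin> Q0"
      then have "a \<noteq> 0" using Q0 by (auto simp: prime_in_def ideal_in_def)
      moreover have "Frob q h \<in> C" using ah(2) q Frob_chart[of q h ?N \<tau>] by (simp add: C_def)
      then have "Fract (Frob q h) a \<in> local_ring ?N \<tau> Q0"
        using a ah(1) by (auto simp: local_ring_def C_def)
      ultimately show False
        using gm Fh ah(5) unfolding maximal_ideal_def
        by (auto simp: One_fract_def eq_fract mult.commute)
    qed
    then have "diag_restrict (p a) = 0"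
      using p\<delta> chart_subset_lattice_algebra ah(1) by (auto simp: Q0_def C_def)
    moreover have "p a \<in> C" using pC[OF *(2)] ah(1) by (simp add: C_def)
    ultimately have pa: "p a \<in> Q"
      using sub by (auto simp: Q0_def)
    have \<pi>g: "?\<pi> g = Fract (p a) h"
      unfolding ah(5) by (rule fract_extension_Fract) (use q p ah chart_subset_lattice_algebra in \<open>auto simp: C_def\<close>)
    \<comment> \<open>An inverse \<open>c / d\<close> would give \<open>c p a = h d\<close>, with
      the left side in \<open>Q\<close> and neither factor of the right side in the prime
      \<open>Q\<close>.\<close>
    have "\<not> (\<exists>k\<in>z. ?\<pi> g * k = 1)"
    proof
      assume "\<exists>k\<in>z. ?\<pi> g * k = 1"
      then obtain c d where cd: "c \<in> C" "d \<in> C" "d \<notin> Q" "?\<pi> g * Fract c d = 1"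
        unfolding zQ local_ring_def C_def by blast
      have "d \<noteq> 0" using cd(3) Q by (auto simp: prime_in_def ideal_in_def)
      then have "c * p a = h * d"
        using cd(4) ah(4) by (simp add: \<pi>g One_fract_def eq_fract mult.commute)
      moreover have "c * p a \<in> Q" using Q cd(1) pa by (auto simp: prime_in_def ideal_in_def)
      ultimately show False using Q ah(2,3) cd(2,3) by (auto simp: prime_in_def)
    qed
    moreover have "?\<pi> g \<in> z"
      using z(2) \<open>?\<pi> g \<in> sections U\<close> by (auto simp: sections_def)
    ultimately show ?thesis by (simp add: maximal_ideal_def)
  qed
  ultimately show "?\<pi> g \<in> ideal_sections (diagonal N \<Sigma>) U"
    by (auto simp: ideal_sections_def)
qed

section \<open>Diagonal splittings from lattice points\<close>

text \<open>
  Exponents are multiplied by \<open>q\<close>: \<open>r a / q\<close> represents the class of \<open>-a / q\<close> in \<open>(1/q) M / M\<close>.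
\<close>

locale diagonal_reps =
  fixes N :: "'v::euclidean_space set" and \<Sigma> :: "'v set set" and R :: "'v set" and q :: int and r :: "'v \<Rightarrow> 'v"
  assumes q: "q > 0" and N0: "0 \<in> N" and R: "R \<subseteq> N"
    and cone: "\<And>\<sigma>. \<sigma> \<in> \<Sigma> \<Longrightarrow> convex_cone \<sigma>"
    and gen: "\<And>\<sigma> u. \<sigma> \<in> \<Sigma> \<Longrightarrow> (\<And>v. v \<in> R \<inter> \<sigma> \<Longrightarrow> 0 \<le> u \<bullet> v) \<Longrightarrow> u \<in> dual_cone \<sigma>"
    and r_rep: "\<And>a. a \<in> dual_lattice N \<Longrightarrow> (1 / of_int q) *\<^sub>R (a + r a) \<in> dual_lattice N"
    and r_periodic: "\<And>a c. a \<in> dual_lattice N \<Longrightarrow> c \<in> dual_lattice N \<Longrightarrow> r (of_int q *\<^sub>R c + a) = r a"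
    and r_0: "r 0 = 0"
    and r_bound: "\<And>a v. a \<in> dual_lattice N \<Longrightarrow> v \<in> R \<Longrightarrow> \<bar>r a \<bullet> v\<bar> < of_int q"
begin

abbreviation "M \<equiv> dual_lattice N"

definition term_map :: "'v \<times> 'v \<Rightarrow> ('v \<times> 'v, 'k::field) laurent" where
  "term_map = (\<lambda>(a, b). if (1 / of_int q) *\<^sub>R (a + b) \<in> M
     then monomial ((1 / of_int q) *\<^sub>R (a + r a), (1 / of_int q) *\<^sub>R (b - r a)) 1 else 0)"

definition splitting_map :: "('v \<times> 'v, 'k::field) laurent \<Rightarrow> ('v \<times> 'v, 'k) laurent" where
  "splitting_map = lext term_map"

lemma dual_lattice_prod: "dual_lattice (N \<times> N) = M \<times> M"
  by (simp add: dual_lattice_Times N0)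

text \<open>Linearity over F* on monomials: adding \<open>q u\<close> changes neither the test on
  the sum of the exponents nor, by periodicity of \<open>r\<close>, the correction.\<close>

lemma term_map_shift:
  assumes "u \<in> M \<times> M" "w \<in> M \<times> M"
  shows "term_map (of_int q *\<^sub>R u + w) = monomial u 1 * term_map w"
proof -
  obtain c d a b where [simp]: "u = (c, d)" "w = (a, b)" by (cases u, cases w)
  have M: "c \<in> M" "d \<in> M" "a \<in> M" "b \<in> M" using assms by auto
  have sh: "(1 / of_int q) *\<^sub>R (of_int q *\<^sub>R y + x) = y + (1 / of_int q) *\<^sub>R x" for x y :: 'v
    using q by (simp add: scaleR_add_right)
  have "of_int q *\<^sub>R c + a + (of_int q *\<^sub>R d + b) = of_int q *\<^sub>R (c + d) + (a + b)"
    by (simp add: scaleR_add_right)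
  then have iff: "(1 / of_int q) *\<^sub>R (of_int q *\<^sub>R c + a + (of_int q *\<^sub>R d + b)) \<in> M
      \<longleftrightarrow> (1 / of_int q) *\<^sub>R (a + b) \<in> M"
    by (simp only: sh dual_lattice_add_iff[OF dual_lattice_add[OF M(1,2)]])
  have "(1 / of_int q) *\<^sub>R (of_int q *\<^sub>R c + a + r a) = c + (1 / of_int q) *\<^sub>R (a + r a)"
    "(1 / of_int q) *\<^sub>R (of_int q *\<^sub>R d + b - r a) = d + (1 / of_int q) *\<^sub>R (b - r a)"
    using sh[of c "a + r a"] sh[of d "b - r a"] by (simp_all only: add.assoc add_diff_eq)
  with iff show ?thesis
    by (simp add: term_map_def monomial_mult r_periodic[OF M(3,1)])
qed

lemma splitting_map_linear:
  "Frob_inverse_linear q (N \<times> N) (splitting_map :: ('v \<times> 'v, 'k::field) laurent \<Rightarrow> _)"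
  unfolding Frob_inverse_linear_def
proof (intro conjI allI ballI)
  show "splitting_map (f + g) = splitting_map f + splitting_map g" for f g :: "('v \<times> 'v, 'k) laurent"
    by (simp add: splitting_map_def lext_add)
next
  fix f g :: "('v \<times> 'v, 'k) laurent"
  assume f: "f \<in> lattice_algebra (N \<times> N)" and g: "g \<in> lattice_algebra (N \<times> N)"
  from f have "supp f \<subseteq> M \<times> M" by (simp add: lattice_algebra_def dual_lattice_prod)
  then show "splitting_map (Frob q f * g) = f * splitting_map g"
  proof (induction f rule: laurent_induct)
    case (monomial u c)
    from g have "supp g \<subseteq> M \<times> M" by (simp add: lattice_algebra_def dual_lattice_prod)
    then show ?case
    proof (induction g rule: laurent_induct)
      case (monomial w d)
      have "splitting_map (Frob q (Defs.monomial u c) * Defs.monomial w d)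
          = Defs.monomial 0 (c * d) * (Defs.monomial u 1 * term_map w)"
        unfolding Frob_monomial monomial_mult splitting_map_def lext_monomial
        by (simp only: term_map_shift[OF \<open>u \<in> M \<times> M\<close> \<open>w \<in> M \<times> M\<close>])
      also have "\<dots> = (Defs.monomial u c * Defs.monomial 0 d) * term_map w"
        by (simp only: mult.assoc[symmetric] monomial_mult) simp
      also have "\<dots> = Defs.monomial u c * splitting_map (Defs.monomial w d)"
        by (simp add: splitting_map_def lext_monomial mult.assoc)
      finally show ?case .
    qed (auto simp: splitting_map_def lext_add distrib_left)
  qed (auto simp: splitting_map_def lext_add comorphism_add distrib_right)
qed

text \<open>By \<open>r_0\<close> the exponent (0, 0) stays fixed; with linearity over F* this makes
  the map a left inverse of F*.\<close>

lemma splitting_map_1: "splitting_map 1 = 1"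
proof -
  have "splitting_map (monomial 0 1) = 1"
    unfolding splitting_map_def lext_monomial
    by (simp add: term_map_def zero_prod_def r_0 flip: monomial_one)
  then show ?thesis by simp
qed

text \<open>The pairing with a ray \<open>v\<close> of the cone is an integer \<open>n\<close> with
  \<open>q n > - q\<close>, so \<open>n\<close> is nonnegative. The strict inequality of the
  polytope is exactly what this rounding requires.\<close>

lemma dual_cone_shift:
  assumes "\<sigma> \<in> \<Sigma>" "a \<in> dual_cone \<sigma>" "(1 / of_int q) *\<^sub>R (a + w) \<in> M" "\<And>v. v \<in> R \<Longrightarrow> \<bar>w \<bullet> v\<bar> < of_int q"
  shows "(1 / of_int q) *\<^sub>R (a + w) \<in> dual_cone \<sigma>"
proof (rule gen[OF assms(1)])
  fix v assume v: "v \<in> R \<inter> \<sigma>"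
  have "(1 / of_int q) *\<^sub>R (a + w) \<bullet> v \<in> \<int>"
    using assms(3) v R by (auto simp: dual_lattice_def)
  then obtain n :: int where n: "(1 / of_int q) *\<^sub>R (a + w) \<bullet> v = of_int n" by (auto elim: Ints_cases)
  have "of_int q * of_int n = a \<bullet> v + w \<bullet> v"
    using q by (simp flip: n add: inner_add_left)
  moreover have "a \<bullet> v \<ge> 0" using assms(2) v by (auto simp: dual_cone_def)
  moreover have "w \<bullet> v > - of_int q" using assms(4)[of v] v by auto
  ultimately have "of_int q * of_int n > (- of_int q :: real)" by linarith
  then have "q * n > - q" by (metis of_int_less_iff of_int_minus of_int_mult)
  then have "n > -1" using q by (metis mult_less_cancel_left_pos mult_minus1_right)
  then show "0 \<le> (1 / of_int q) *\<^sub>R (a + w) \<bullet> v" by (simp only: n of_int_0_le_iff)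
qed

text \<open>The bound on \<open>r a\<close> holds for \<open>- r a\<close> too, so
  \<open>dual_cone_shift\<close> applies to each factor.\<close>

lemma term_map_chart:
  assumes \<tau>: "\<tau> \<in> product_fan \<Sigma> \<Sigma>" and u: "u \<in> dual_cone \<tau> \<inter> dual_lattice (N \<times> N)"
  shows "supp (term_map u) \<subseteq> dual_cone \<tau> \<inter> dual_lattice (N \<times> N)"
proof (cases "(1 / of_int q) *\<^sub>R (fst u + snd u) \<in> M")
  case True
  obtain \<sigma> \<sigma>' where \<sigma>: "\<tau> = \<sigma> \<times> \<sigma>'" "\<sigma> \<in> \<Sigma>" "\<sigma>' \<in> \<Sigma>" using \<tau> by (auto simp: product_fan_def)
  then have dc: "dual_cone \<tau> = dual_cone \<sigma> \<times> dual_cone \<sigma>'"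
    using cone by (simp add: dual_cone_Times convex_cone_contains_0)
  obtain a b where [simp]: "u = (a, b)" by (cases u)
  have ab: "a \<in> dual_cone \<sigma>" "b \<in> dual_cone \<sigma>'" "a \<in> M" "b \<in> M"
    using u by (auto simp: dc dual_lattice_prod)
  have 1: "(1 / of_int q) *\<^sub>R (a + r a) \<in> M" by (rule r_rep[OF ab(3)])
  \<comment> \<open>Integrality of the second exponent follows from that of the first, since their
    sum is \<open>(a + b) / q\<close>.\<close>
  have "(1 / of_int q) *\<^sub>R (b + - r a) = (1 / of_int q) *\<^sub>R (a + b) - (1 / of_int q) *\<^sub>R (a + r a)"
    by (simp add: algebra_simps)
  then have 2: "(1 / of_int q) *\<^sub>R (b + - r a) \<in> M"
    using True dual_lattice_diff[OF _ 1] by simp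
  have "(1 / of_int q) *\<^sub>R (a + r a) \<in> dual_cone \<sigma>"
    using dual_cone_shift[OF \<sigma>(2) ab(1) 1] r_bound[OF ab(3)] by simp
  moreover have "(1 / of_int q) *\<^sub>R (b + - r a) \<in> dual_cone \<sigma>'"
    using dual_cone_shift[OF \<sigma>(3) ab(2) 2] r_bound[OF ab(3)] by simp
  ultimately show ?thesis
    using 1 2 by (simp add: term_map_def supp_monomial dc dual_lattice_prod)
qed (simp add: term_map_def case_prod_beta)

lemma splitting_map_chart:
  assumes "\<tau> \<in> product_fan \<Sigma> \<Sigma>" "f \<in> chart (N \<times> N) \<tau>"
  shows "splitting_map f \<in> chart (N \<times> N) \<tau>"
  using assms(2) term_map_chart[OF assms(1)] supp_lext[of term_map f]
  unfolding chart_def splitting_map_def by blast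

text \<open>The corrections \<open>r a\<close> and \<open>- r a\<close> cancel in the sum of the
  exponents. So restriction intertwines the map with a map \<open>s\<close> on X, and the kernel of
  restriction is preserved.\<close>

lemma diag_restrict_splitting_map:
  fixes f :: "('v \<times> 'v, 'k::field) laurent"
  assumes "diag_restrict f = 0" shows "diag_restrict (splitting_map f) = 0"
proof -
  \<comment> \<open>This is the standard toric splitting map of X: divide the exponent by
    \<open>q\<close> if the result lies in M, otherwise return 0.\<close>
  define s :: "('v, 'k) laurent \<Rightarrow> ('v, 'k) laurent" where
    "s = lext (\<lambda>u. if (1 / of_int q) *\<^sub>R u \<in> M then monomial ((1 / of_int q) *\<^sub>R u) 1 else 0)"
  have "diag_restrict (splitting_map f) = s (diag_restrict f)"
  proof (induction f rule: laurent_induct[OF subset_UNIV])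
    case (3 u c)
    obtain a b where [simp]: "u = (a, b)" by (cases u)
    have "(1 / of_int q) *\<^sub>R (a + r a) + (1 / of_int q) *\<^sub>R (b - r a) = (1 / of_int q) *\<^sub>R (a + b)"
      by (simp add: algebra_simps)
    then show ?case
      by (auto simp: splitting_map_def s_def lext_monomial term_map_def comorphism_monomial adjoint_diag
          comorphism_mult[OF linear_diag] monomial_mult)
  qed (auto simp: splitting_map_def s_def lext_add comorphism_add)
  then show ?thesis by (simp add: assms s_def)
qed

theorem diagonally_split_of_reps: "diagonally_split TYPE('k::field) N \<Sigma> q"
proof -
  let ?p = "splitting_map :: ('v \<times> 'v, 'k) laurent \<Rightarrow> _"
  have \<Sigma>: "of_int q *\<^sub>R x \<in> \<tau>" if "\<tau> \<in> product_fan \<Sigma> \<Sigma>" "x \<in> \<tau>" for \<tau> x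
    using that q cone by (auto simp: product_fan_def intro!: convex_cone_scaleR convex_cone_Times)
  have "is_splitting q (N \<times> N) (product_fan \<Sigma> \<Sigma>) (\<lambda>U. fract_extension q (N \<times> N) ?p)"
    by (rule is_splitting_fract_extension[OF q \<Sigma> splitting_map_linear splitting_map_1 splitting_map_chart])
  moreover from this have "compatible q (N \<times> N) (product_fan \<Sigma> \<Sigma>) (diagonal N \<Sigma>) (\<lambda>U. fract_extension q (N \<times> N) ?p)"
    by (intro compatible_diagonal[OF q \<Sigma> splitting_map_linear _ splitting_map_chart diag_restrict_splitting_map])
  ultimately show ?thesis
    unfolding diagonally_split_def by (intro exI conjI)
qed

end

section \<open>Cones are generated by their rays\<close>

text \<open>Redundant generators are discarded one at a time, which leaves the hull
  unchanged.\<close>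

lemma minimal_cone_generators:
  assumes "finite S"
  shows "\<exists>T\<subseteq>S. convex_cone hull T = convex_cone hull S \<and> (\<forall>t\<in>T. t \<notin> convex_cone hull (T - {t}))"
  using assms
proof (induction S rule: finite_psubset_induct)
  case (psubset S)
  show ?case
  proof (cases "\<exists>s\<in>S. s \<in> convex_cone hull (S - {s})")
    case True
    then obtain s where s: "s \<in> S" "s \<in> convex_cone hull (S - {s})" by blast
    then have eq: "convex_cone hull S = convex_cone hull (S - {s})"
      using hull_redundant[OF s(2)] by (simp add: insert_absorb)
    have "S - {s} \<subset> S" using s(1) by auto
    then obtain T where "T \<subseteq> S - {s}" "convex_cone hull T = convex_cone hull (S - {s})"
      "\<forall>t\<in>T. t \<notin> convex_cone hull (T - {t})"
      using psubset.IH by metis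
    then show ?thesis unfolding eq by (intro exI[of _ T]) auto
  next
    case False
    then show ?thesis by (intro exI[of _ S]) auto
  qed
qed

lemma convex_cone_hull_singleton: "convex_cone hull {s} = {c *\<^sub>R s | c. c \<ge> 0}"
proof
  show "convex_cone hull {s} \<subseteq> {c *\<^sub>R s | c. c \<ge> 0}"
  proof (rule hull_minimal)
    have "s = 1 *\<^sub>R s" by simp
    then show "{s} \<subseteq> {c *\<^sub>R s | c. c \<ge> 0}" by fastforce
    have "0 = 0 *\<^sub>R s" by simp
    moreover have "a *\<^sub>R s + b *\<^sub>R s = (a + b) *\<^sub>R s" for a b by (simp add: scaleR_add_left)
    moreover have "a *\<^sub>R b *\<^sub>R s = (a * b) *\<^sub>R s" for a b by simp
    ultimately show "convex_cone {c *\<^sub>R s | c. c \<ge> 0}"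
      unfolding convex_cone_iff by (smt (verit, best) mem_Collect_eq mult_nonneg_nonneg)
  qed
  show "{c *\<^sub>R s | c. c \<ge> 0} \<subseteq> convex_cone hull {s}"
    using convex_cone_hull_mul[OF hull_inc[of s "{s}"]] by auto
qed

text \<open>Let \<open>c s\<close> lie between \<open>a\<close> and \<open>b\<close>, and split off
  their multiples of \<open>s\<close>, leaving \<open>a'\<close> and \<open>b'\<close> in the cone
  of the other generators. Comparison gives \<open>k s = w\<close> with \<open>w\<close> a convex
  combination of \<open>a'\<close> and \<open>b'\<close>. If \<open>k > 0\<close> then
  \<open>s\<close> is redundant; otherwise \<open>w\<close> and \<open>- w\<close> lie in the cone,
  so strong convexity forces \<open>w = 0\<close> and then \<open>a' = b' = 0\<close>.\<close>

lemma minimal_generator_face: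
  fixes S :: "'v::euclidean_space set"
  assumes sc: "strongly_convex (convex_cone hull S)" and s: "s \<in> S" "s \<notin> convex_cone hull (S - {s})"
  shows "(convex_cone hull {s}) face_of (convex_cone hull S)"
proof -
  let ?\<sigma> = "convex_cone hull S" and ?T = "convex_cone hull (S - {s})" and ?\<rho> = "convex_cone hull {s}"
  have \<rho>\<sigma>: "?\<rho> \<subseteq> ?\<sigma>" and T\<sigma>: "?T \<subseteq> ?\<sigma>" using s(1) by (auto intro!: hull_mono)
  have pointed: "x = 0" if "x \<in> ?\<sigma>" "- x \<in> ?\<sigma>" for x
  proof -
    have "x \<in> ?\<sigma> \<inter> uminus ` ?\<sigma>" using that by (auto intro: image_eqI[of _ _ "- x"])
    then show ?thesis using sc unfolding strongly_convex_def by blast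
  qed
  have dec: "\<exists>\<alpha> x'. \<alpha> \<ge> 0 \<and> x' \<in> ?T \<and> x = \<alpha> *\<^sub>R s + x'" if "x \<in> ?\<sigma>" for x
  proof -
    have "?\<sigma> = convex_cone hull ({s} \<union> (S - {s}))" using s(1) by (simp add: insert_absorb)
    then show ?thesis
      using that unfolding convex_cone_hull_Un convex_cone_hull_singleton by auto
  qed
  have "a \<in> ?\<rho> \<and> b \<in> ?\<rho>" if ab: "a \<in> ?\<sigma>" "b \<in> ?\<sigma>" "z \<in> ?\<rho>" "z \<in> open_segment a b" for a b z
  proof -
    obtain c where c: "c \<ge> 0" "z = c *\<^sub>R s" using ab(3) by (auto simp: convex_cone_hull_singleton)
    obtain t where t: "0 < t" "t < 1" "z = (1 - t) *\<^sub>R a + t *\<^sub>R b" using ab(4) by (auto simp: in_segment)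
    obtain \<alpha> a' where a: "\<alpha> \<ge> 0" "a' \<in> ?T" "a = \<alpha> *\<^sub>R s + a'" using dec[OF ab(1)] by blast
    obtain \<beta> b' where b: "\<beta> \<ge> 0" "b' \<in> ?T" "b = \<beta> *\<^sub>R s + b'" using dec[OF ab(2)] by blast
    define k where "k = c - (1 - t) * \<alpha> - t * \<beta>"
    define w where "w = (1 - t) *\<^sub>R a' + t *\<^sub>R b'"
    have wT: "w \<in> ?T"
      unfolding w_def using a(2) b(2) t by (intro convex_cone_hull_add convex_cone_hull_mul) auto
    have kw: "k *\<^sub>R s = w"
      using c(2) t(3) unfolding a(3) b(3) k_def w_def by (simp add: algebra_simps)
    have "k \<le> 0"
    proof (rule ccontr)
      assume "\<not> k \<le> 0"
      then have "s = (1 / k) *\<^sub>R w" by (simp flip: kw)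
      then show False using s(2) convex_cone_hull_mul[OF wT, of "1 / k"] \<open>\<not> k \<le> 0\<close> by simp
    qed
    then have "- w \<in> ?\<sigma>"
      using convex_cone_hull_mul[OF hull_inc[OF s(1)], of "- k"] kw by simp
    then have w0: "w = 0" using pointed wT T\<sigma> by blast
    \<comment> \<open>A vanishing combination with positive coefficients makes \<open>- x\<close> a
      positive multiple of \<open>y\<close>, so pointedness applies once more.\<close>
    have zero: "x = 0" if "x \<in> ?T" "y \<in> ?T" "\<mu> *\<^sub>R x + \<nu> *\<^sub>R y = 0" "\<mu> > 0" "\<nu> > 0" for x y \<mu> \<nu>
    proof -
      have "\<mu> *\<^sub>R (- x) = \<nu> *\<^sub>R y" using that(3) by (simp add: eq_neg_iff_add_eq_0 neg_eq_iff_add_eq_0)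
      then have "(1 / \<mu>) *\<^sub>R \<mu> *\<^sub>R (- x) = (1 / \<mu>) *\<^sub>R \<nu> *\<^sub>R y" by simp
      then have "- x = (\<nu> / \<mu>) *\<^sub>R y" using that(4) by simp
      then show ?thesis
        using pointed[of x] T\<sigma> that convex_cone_hull_mul[of y "S - {s}" "\<nu> / \<mu>"] by auto
    qed
    have "a' = 0" "b' = 0"
      using zero[OF a(2) b(2), of "1 - t" t] zero[OF b(2) a(2), of t "1 - t"] t w0
      by (auto simp: w_def add.commute)
    then show ?thesis using a b by (auto simp: convex_cone_hull_singleton)
  qed
  then show ?thesis
    unfolding face_of_def using \<rho>\<sigma> convex_convex_cone_hull by blast
qed

text \<open>Irredundant generators span one-dimensional faces, which belong to the fan, so each is a
  positive multiple of a ray generator in the cone. Nonnegativity then passes to the convex cone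
  they generate.\<close>

lemma dual_cone_rays:
  fixes N :: "'v::euclidean_space set"
  assumes prim: "\<And>s. s \<in> N \<Longrightarrow> s \<noteq> 0 \<Longrightarrow> \<exists>v c. primitive N v \<and> c > 0 \<and> s = c *\<^sub>R v"
    and fan: "is_fan N \<Sigma>" and \<sigma>: "\<sigma> \<in> \<Sigma>" and u: "\<And>v. v \<in> rays N \<Sigma> \<inter> \<sigma> \<Longrightarrow> 0 \<le> u \<bullet> v"
  shows "u \<in> dual_cone \<sigma>"
proof -
  obtain S0 where S0: "finite S0" "S0 \<subseteq> N" "\<sigma> = convex_cone hull S0"
    using fan \<sigma> unfolding is_fan_def rational_cone_def by metis
  obtain S where S: "S \<subseteq> S0" "convex_cone hull S = \<sigma>" "\<And>s. s \<in> S \<Longrightarrow> s \<notin> convex_cone hull (S - {s})"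
    using minimal_cone_generators[OF S0(1)] unfolding S0(3)[symmetric] by blast
  have "0 \<le> u \<bullet> s" if s: "s \<in> S" for s
  proof -
    let ?\<rho> = "convex_cone hull {s}"
    have "s \<noteq> 0" using S(3)[OF s] convex_cone_hull_contains_0[of "S - {s}"] by auto
    then obtain v c where v: "primitive N v" "c > 0" "s = c *\<^sub>R v" using prim S(1) S0(2) s by blast
    have "strongly_convex \<sigma>" using fan \<sigma> by (simp add: is_fan_def)
    then have face: "?\<rho> face_of \<sigma>"
      using minimal_generator_face[OF _ s S(3)[OF s]] unfolding S(2) by blast
    then have "?\<rho> \<in> \<Sigma>"
      using fan \<sigma> convex_cone_hull_nonempty[of "{s}"] unfolding is_fan_def cone_face_def by blast
    moreover have sub: "?\<rho> \<subseteq> \<sigma>" using face by (rule face_of_imp_subset)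
    moreover have "card {s} = dim ?\<rho>"
    proof (rule basis_card_eq_dim)
      show "{s} \<subseteq> ?\<rho>" by (rule hull_subset)
      show "?\<rho> \<subseteq> span {s}" by (auto simp: convex_cone_hull_singleton span_singleton)
    qed (use \<open>s \<noteq> 0\<close> in simp)
    moreover have "v \<in> ?\<rho>"
      unfolding convex_cone_hull_singleton using v(2,3) by (auto intro!: exI[of _ "1 / c"])
    ultimately have "v \<in> rays N \<Sigma> \<inter> \<sigma>"
      using v(1) by (auto simp: rays_def)
    then show ?thesis using u v(2,3) by simp
  qed
  then have "S \<subseteq> {x. u \<bullet> x \<ge> 0}" by auto
  then have "convex_cone hull S \<subseteq> {x. u \<bullet> x \<ge> 0}"
    by (rule hull_minimal) (rule convex_cone_halfspace_ge)
  then show ?thesis using S(2) by (auto simp: dual_cone_def)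
qed

section \<open>Lattices of rank two\<close>

text \<open>
  If some determinant is \<open>2\<close>, half the sum and half the difference of the two vectors are a basis;
  otherwise any two vectors with nonzero determinant are one.
\<close>

lemma unimodular_of_small_dets:
  fixes S :: "(int \<times> int) set"
  assumes cop: "\<And>x y. (x, y) \<in> S \<Longrightarrow> coprime x y"
    and det: "\<And>a b c d. (a, b) \<in> S \<Longrightarrow> (c, d) \<in> S \<Longrightarrow> \<bar>a * d - b * c\<bar> \<le> 2"
  obtains i j k l where "\<bar>i * l - j * k\<bar> = 1"
    "\<And>x y. (x, y) \<in> S \<Longrightarrow> \<bar>x * l - y * k\<bar> \<le> 1 \<and> \<bar>i * y - j * x\<bar> \<le> 1"
proof -
  consider (two) a b c d where "(a, b) \<in> S" "(c, d) \<in> S" "\<bar>a * d - b * c\<bar> = 2"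
    | (one) a b c d where "(a, b) \<in> S" "(c, d) \<in> S" "\<bar>a * d - b * c\<bar> = 1"
        "\<And>a b c d. (a, b) \<in> S \<Longrightarrow> (c, d) \<in> S \<Longrightarrow> \<bar>a * d - b * c\<bar> \<le> 1"
    | (zero) "\<And>a b c d. (a, b) \<in> S \<Longrightarrow> (c, d) \<in> S \<Longrightarrow> a * d - b * c = 0"
  proof (cases "\<exists>a b c d. (a, b) \<in> S \<and> (c, d) \<in> S \<and> \<bar>a * d - b * c\<bar> = 2")
    case False
    then have le: "\<bar>a * d - b * c\<bar> \<le> 1" if "(a, b) \<in> S" "(c, d) \<in> S" for a b c d
      using det[OF that] that by (metis (no_types, opaque_lifting) dual_order.order_iff_strict one_add_one zle_add1_eq_le)
    show thesis
    proof (cases "\<exists>a b c d. (a, b) \<in> S \<and> (c, d) \<in> S \<and> \<bar>a * d - b * c\<bar> = 1")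
      case True
      then show thesis using that(2) le by blast
    next
      case nex: False
      have "a * d - b * c = 0" if "(a, b) \<in> S" "(c, d) \<in> S" for a b c d
      proof -
        have "\<bar>a * d - b * c\<bar> \<noteq> 1" using nex that by blast
        then show ?thesis using le[OF that] by linarith
      qed
      then show thesis using that(3) by blast
    qed
  qed (use that(1) in blast)
  then show thesis
  proof cases
    case two
    have cops: "coprime a b" "coprime c d" using cop two by blast+
    then have "odd a \<or> odd b" "odd c \<or> odd d" by (meson coprime_common_divisor odd_one)+
    moreover have "even (a * d - b * c)" using two(3) by presburger
    \<comment> \<open>Modulo 2 both vectors are nonzero and their determinant vanishes, so they
      agree.\<close>
    ultimately have "even (a + c)" "even (b + d)" by auto
    then obtain i j where ij: "a + c = 2 * i" "b + d = 2 * j" unfolding dvd_def by blast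
    define k l where "k = a - i" and "l = b - j"
    have abcd: "a = i + k" "c = i - k" "b = j + l" "d = j - l" using ij by (auto simp: k_def l_def)
    have ad: "a * d - b * c = - 2 * (i * l - j * k)" unfolding abcd by (simp add: algebra_simps)
    have e: "\<bar>i * l - j * k\<bar> = 1" using two(3) unfolding ad abs_mult by simp
    show thesis
    proof (rule that[OF e])
      fix x y assume xy: "(x, y) \<in> S"
      \<comment> \<open>\<open>A\<close> and \<open>B\<close> are the coordinates of
        \<open>(x, y)\<close> in the new basis, up to the sign of its determinant. Determinants with
        the original two vectors become \<open>A - B\<close> and \<open>- B - A\<close>.\<close>
      define A where "A = x * l - y * k"
      define B where "B = i * y - j * x"
      have "x * b - y * a = A - B" "x * d - y * c = - B - A"
        unfolding abcd A_def B_def by (simp_all add: algebra_simps)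
      then have AB: "\<bar>A - B\<bar> \<le> 2" "\<bar>A + B\<bar> \<le> 2" using det[OF xy two(1)] det[OF xy two(2)] by linarith+
      have ex: "(i * l - j * k) * x = A * i + B * k" "(i * l - j * k) * y = A * j + B * l"
        unfolding A_def B_def by (simp_all add: algebra_simps)
      have "\<not> (even A \<and> even B)"
      proof
        assume "even A \<and> even B"
        then have "even ((i * l - j * k) * x)" "even ((i * l - j * k) * y)" unfolding ex by auto
        moreover have "odd (i * l - j * k)" using e by presburger
        ultimately have "even x" "even y" by (metis even_mult_iff)+
        then show False using cop[OF xy] coprime_common_divisor odd_one by blast
      qed
      \<comment> \<open>The bounds say that the absolute values of \<open>A\<close> and
        \<open>B\<close> add up to at most 2. An entry of absolute value 2 would force the other to
        be 0, making both even.\<close>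
      then have "\<bar>A\<bar> \<le> 1 \<and> \<bar>B\<bar> \<le> 1" using AB by presburger
      then show "\<bar>x * l - y * k\<bar> \<le> 1 \<and> \<bar>i * y - j * x\<bar> \<le> 1" by (simp add: A_def B_def)
    qed
  next
    case one
    show thesis
      by (rule that[of a d b c]) (use one in auto)
  next
    case zero
    show thesis
    proof (cases "S = {}")
      case True
      then show thesis using that[of 1 1 0 0] by simp
    next
      case False
      then obtain a b where ab: "(a, b) \<in> S" by auto
      then have "coprime a b" by (rule cop)
      then obtain s t where st: "s * a + t * b = 1" using bezout_int[of a b] by auto
      show thesis
      \<comment> \<open>All vectors are proportional to the primitive vector \<open>(a, b)\<close>,
        which the Bezout coefficients complete to a basis by \<open>(- t, s)\<close>.\<close>
      proof (rule that[of a s b "- t"])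
        show "\<bar>a * s - b * - t\<bar> = 1" using st by (simp add: mult.commute)
        fix x y assume xy: "(x, y) \<in> S"
        have z: "a * y = b * x" using zero[OF ab xy] by simp
        \<comment> \<open>\<open>m\<close> is the factor in \<open>(x, y) = m (a, b)\<close>;
          coprimality of \<open>x\<close> and \<open>y\<close> makes it a unit.\<close>
        define m where "m = s * x + t * y"
        have "m * a = (s * a) * x + t * (a * y)" by (simp add: m_def algebra_simps)
        also have "\<dots> = (s * a + t * b) * x" by (simp add: z algebra_simps)
        finally have "x = m * a" by (simp add: st)
        have "m * b = s * (b * x) + t * b * y" by (simp add: m_def algebra_simps)
        also have "\<dots> = (s * a + t * b) * y" by (simp add: z[symmetric] algebra_simps)
        finally have "y = m * b" by (simp add: st)
        then have "is_unit m" using cop[OF xy] \<open>x = m * a\<close> by (meson coprime_common_divisor dvd_triv_left)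
        then show "\<bar>x * s - y * - t\<bar> \<le> 1 \<and> \<bar>a * y - b * x\<bar> \<le> 1"
          using z by (simp add: m_def mult.commute)
      qed
    qed
  qed
qed

text \<open>The equations express twice each standard basis vector through \<open>(a, b)\<close> and
  \<open>(c, d)\<close>. The coefficient determinant \<open>E\<close> satisfies
  \<open>E * \<Delta> = 4\<close>, where \<open>\<Delta>\<close> is the determinant to be bounded.
  By Cramer's rule \<open>E * a\<close> and \<open>E * b\<close> are even; as \<open>a\<close> and
  \<open>b\<close> are coprime, \<open>E\<close> is even, so \<open>\<Delta>\<close> divides
  2.\<close>

lemma det_le_2:
  fixes a b c d :: int
  assumes "2 = m * a + n * c" "0 = m * b + n * d" "0 = m' * a + n' * c" "2 = m' * b + n' * d" "coprime a b"
  shows "\<bar>a * d - b * c\<bar> \<le> 2"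
proof -
  let ?\<Delta> = "a * d - b * c" and ?E = "m * n' - n * m'"
  have "?E * ?\<Delta> = (m * a + n * c) * (m' * b + n' * d) - (m * b + n * d) * (m' * a + n' * c)"
    by (simp add: algebra_simps)
  then have 4: "?E * ?\<Delta> = 4" by (simp flip: assms(1-4))
  have "?E * a = n' * (m * a + n * c) - n * (m' * a + n' * c)" by (simp add: algebra_simps)
  then have Ea: "?E * a = 2 * n'" by (simp flip: assms(1,3))
  have "?E * b = n' * (m * b + n * d) - n * (m' * b + n' * d)" by (simp add: algebra_simps)
  then have Eb: "?E * b = - 2 * n" by (simp flip: assms(2,4))
  have "\<not> (even a \<and> even b)" using assms(5) coprime_common_divisor odd_one by blast
  moreover have "even (?E * a)" "even (?E * b)" unfolding Ea Eb by auto
  ultimately have "even ?E" by (metis even_mult_iff)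
  then obtain e where e: "?E = 2 * e" unfolding dvd_def by blast
  then have "?\<Delta> dvd 2" using 4 by (intro dvdI[of _ _ e]) (simp add: mult.commute)
  then show ?thesis using dvd_imp_le_int[of 2 ?\<Delta>] by simp
qed

section \<open>Coordinates on a lattice of rank two\<close>

lemma int_span_pair:
  assumes "b1 \<noteq> b2"
  shows "int_span {b1, b2} = {of_int m *\<^sub>R b1 + of_int n *\<^sub>R b2 | m n. True}"
proof
  show "int_span {b1, b2} \<subseteq> {of_int m *\<^sub>R b1 + of_int n *\<^sub>R b2 | m n. True}"
  proof
    fix x assume "x \<in> int_span {b1, b2}"
    then obtain F c where F: "F \<subseteq> {b1, b2}" "x = (\<Sum>b\<in>F. of_int (c b) *\<^sub>R b)"
      by (auto simp: int_span_def)
    have "x = (\<Sum>b\<in>{b1, b2}. of_int (if b \<in> F then c b else 0) *\<^sub>R b)"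
      unfolding F(2) using F(1) by (intro sum.mono_neutral_cong_left) auto
    also have "\<dots> = of_int (if b1 \<in> F then c b1 else 0) *\<^sub>R b1 + of_int (if b2 \<in> F then c b2 else 0) *\<^sub>R b2"
      using assms by simp
    finally show "x \<in> {of_int m *\<^sub>R b1 + of_int n *\<^sub>R b2 | m n. True}" by blast
  qed
  show "{of_int m *\<^sub>R b1 + of_int n *\<^sub>R b2 | m n. True} \<subseteq> int_span {b1, b2}"
  proof clarify
    fix m n :: int
    have "of_int m *\<^sub>R b1 + of_int n *\<^sub>R b2 = (\<Sum>b\<in>{b1, b2}. of_int (if b = b1 then m else n) *\<^sub>R b)"
      using assms by simp
    then show "of_int m *\<^sub>R b1 + of_int n *\<^sub>R b2 \<in> int_span {b1, b2}"
      unfolding int_span_def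
      by (intro CollectI exI[of _ "{b1, b2}"] exI[of _ "\<lambda>b. if b = b1 then m else n"]) simp
  qed
qed

text \<open>\<open>c1\<close>, \<open>c2\<close> is the basis dual to \<open>b1\<close>,
  \<open>b2\<close>, so pairings with \<open>c1\<close> and \<open>c2\<close> are coordinates on
  N_R, and N consists of the points with integer coordinates.\<close>

locale plane_lattice =
  fixes N :: "'v::euclidean_space set" and b1 b2 c1 c2 :: 'v
  assumes dim: "DIM('v) = 2"
    and dual: "b1 \<bullet> c1 = 1" "b1 \<bullet> c2 = 0" "b2 \<bullet> c1 = 0" "b2 \<bullet> c2 = 1"
    and expand: "\<And>x. x = (x \<bullet> c1) *\<^sub>R b1 + (x \<bullet> c2) *\<^sub>R b2"
    and N_eq: "N = {x. x \<bullet> c1 \<in> \<int> \<and> x \<bullet> c2 \<in> \<int>}"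

lemma plane_lattice_exists:
  fixes N :: "'v::euclidean_space set"
  assumes "DIM('v) = 2" "is_lattice N"
  obtains b1 b2 c1 c2 where "plane_lattice N b1 b2 c1 c2"
proof -
  obtain B where B: "independent B" "span B = UNIV" "N = int_span B"
    using assms(2) by (auto simp: is_lattice_def)
  have "card B = 2" using dim_eq_card[of B UNIV] B assms(1) by simp
  then obtain b1 b2 where b: "B = {b1, b2}" "b1 \<noteq> b2" by (auto simp: card_2_iff)
  \<comment> \<open>A functional prescribed on the basis is extended linearly to \<open>f\<close>
    and represented by the vector \<open>adjoint f 1\<close>.\<close>
  have riesz: "\<exists>c. \<forall>b\<in>B. b \<bullet> c = \<phi> b" for \<phi> :: "'v \<Rightarrow> real"
  proof -
    obtain f where f: "linear f" "\<forall>x\<in>B. f x = \<phi> x"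
      using linear_independent_extend[OF B(1)] by blast
    have "x \<bullet> adjoint f 1 = f x" for x using adjoint_works[OF f(1), of x 1] by simp
    with f(2) show ?thesis by (intro exI[of _ "adjoint f 1"]) simp
  qed
  obtain c1 where c1: "b1 \<bullet> c1 = 1" "b2 \<bullet> c1 = 0"
    using riesz[of "\<lambda>b. if b = b1 then 1 else 0"] b by auto
  obtain c2 where c2: "b1 \<bullet> c2 = 0" "b2 \<bullet> c2 = 1"
    using riesz[of "\<lambda>b. if b = b2 then 1 else 0"] b by auto
  have expand: "x = (x \<bullet> c1) *\<^sub>R b1 + (x \<bullet> c2) *\<^sub>R b2" for x
  proof -
    have "x \<in> span {b1, b2}" using B(2) b by simp
    then obtain k l where "x = k *\<^sub>R b1 + l *\<^sub>R b2"
      by (auto simp: span_insert span_singleton algebra_simps)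
    then show ?thesis using c1 c2 by (simp add: inner_add_left)
  qed
  have "N = {x. x \<bullet> c1 \<in> \<int> \<and> x \<bullet> c2 \<in> \<int>}"
  proof (intro Set.set_eqI iffI)
    fix x assume "x \<in> N"
    then show "x \<in> {x. x \<bullet> c1 \<in> \<int> \<and> x \<bullet> c2 \<in> \<int>}"
      using c1 c2 unfolding B(3) b(1) int_span_pair[OF b(2)] by (auto simp: inner_add_left)
  next
    fix x assume "x \<in> {x. x \<bullet> c1 \<in> \<int> \<and> x \<bullet> c2 \<in> \<int>}"
    then obtain m n where "x \<bullet> c1 = of_int m" "x \<bullet> c2 = of_int n" by (auto elim!: Ints_cases)
    then show "x \<in> N"
      using expand[of x] unfolding B(3) b(1) int_span_pair[OF b(2)] by auto
  qed
  then show thesis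
    using that[of b1 b2 c1 c2] assms(1) c1 c2 expand by (simp add: plane_lattice_def)
qed

context plane_lattice
begin

lemma dual_expand: "u = (u \<bullet> b1) *\<^sub>R c1 + (u \<bullet> b2) *\<^sub>R c2"
proof -
  have "x \<bullet> u = x \<bullet> ((u \<bullet> b1) *\<^sub>R c1 + (u \<bullet> b2) *\<^sub>R c2)" for x
    by (subst expand[of x]) (simp add: inner_add_left inner_add_right inner_commute dual)
  then show ?thesis by (metis vector_eq_ldot)
qed

lemma dual_lattice_eq: "dual_lattice N = {u. u \<bullet> b1 \<in> \<int> \<and> u \<bullet> b2 \<in> \<int>}"
proof (intro Set.set_eqI iffI)
  fix u assume "u \<in> dual_lattice N"
  then show "u \<in> {u. u \<bullet> b1 \<in> \<int> \<and> u \<bullet> b2 \<in> \<int>}"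
    by (auto simp: dual_lattice_def N_eq dual)
next
  fix u assume u: "u \<in> {u. u \<bullet> b1 \<in> \<int> \<and> u \<bullet> b2 \<in> \<int>}"
  have "u \<bullet> v \<in> \<int>" if "v \<in> N" for v
    by (subst expand[of v]) (use u that in \<open>auto simp: inner_add_right N_eq\<close>)
  then show "u \<in> dual_lattice N" by (auto simp: dual_lattice_def)
qed

lemma lattice_eqI:
  assumes "x \<bullet> c1 = y \<bullet> c1" "x \<bullet> c2 = y \<bullet> c2" shows "x = y"
  using expand[of x] unfolding assms expand[of y, symmetric] .

lemma comb_coords [simp]:
  "(x *\<^sub>R b1 + y *\<^sub>R b2) \<bullet> c1 = x" "(x *\<^sub>R b1 + y *\<^sub>R b2) \<bullet> c2 = y"
  by (simp_all add: inner_add_left dual)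

lemma primitive_coords:
  assumes "primitive N v"
  obtains a b :: int where "v \<bullet> c1 = of_int a" "v \<bullet> c2 = of_int b" "coprime a b"
proof -
  have "v \<bullet> c1 \<in> \<int>" "v \<bullet> c2 \<in> \<int>" using assms by (auto simp: primitive_def N_eq)
  then obtain a b :: int where ab: "v \<bullet> c1 = of_int a" "v \<bullet> c2 = of_int b" by (auto elim!: Ints_cases)
  obtain a' b' where g: "a = gcd a b * a'" "b = gcd a b * b'" by (meson dvdE gcd_dvd1 gcd_dvd2)
  let ?w = "of_int a' *\<^sub>R b1 + of_int b' *\<^sub>R b2"
  have "v = of_int (gcd a b) *\<^sub>R ?w"
    by (rule lattice_eqI) (simp_all add: ab del: scaleR_add_right flip: of_int_mult g)
  moreover have "?w \<in> N" by (simp add: N_eq)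
  ultimately have "\<bar>gcd a b\<bar> = 1" using assms unfolding primitive_def by blast
  then show thesis using that ab by (simp add: coprime_iff_gcd_eq_1)
qed

text \<open>The factor \<open>c\<close> is the gcd of the coordinates of \<open>s\<close>.\<close>

lemma primitive_generator:
  assumes "s \<in> N" "s \<noteq> 0"
  shows "\<exists>v c. primitive N v \<and> c > 0 \<and> s = c *\<^sub>R v"
proof -
  obtain a b :: int where ab: "s \<bullet> c1 = of_int a" "s \<bullet> c2 = of_int b"
    using assms(1) by (auto simp: N_eq elim!: Ints_cases)
  have "\<not> (a = 0 \<and> b = 0)"
    using assms(2) lattice_eqI[of s 0] ab by auto
  then obtain a' b' where g: "a = gcd a b * a'" "b = gcd a b * b'" "coprime a' b'"
    using gcd_coprime_exists[of a b] by (auto simp: mult.commute)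
  let ?v = "of_int a' *\<^sub>R b1 + of_int b' *\<^sub>R b2"
  have pos: "gcd a b > 0" using \<open>\<not> (a = 0 \<and> b = 0)\<close> by auto
  have s: "s = of_int (gcd a b) *\<^sub>R ?v"
    by (rule lattice_eqI) (simp_all add: ab del: scaleR_add_right flip: of_int_mult g(1,2))
  have "primitive N ?v"
    unfolding primitive_def
  proof (intro conjI ballI allI impI)
    show "?v \<in> N" by (simp add: N_eq)
    show "?v \<noteq> 0" using assms(2) s by auto
    fix w and m :: int assume w: "w \<in> N" "?v = of_int m *\<^sub>R w"
    obtain x y :: int where xy: "w \<bullet> c1 = of_int x" "w \<bullet> c2 = of_int y"
      using w(1) by (auto simp: N_eq elim!: Ints_cases)
    have "of_int a' = (of_int m * of_int x :: real)" "of_int b' = (of_int m * of_int y :: real)"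
      using arg_cong[OF w(2), of "\<lambda>z. z \<bullet> c1"] arg_cong[OF w(2), of "\<lambda>z. z \<bullet> c2"] xy by simp_all
    then have "a' = m * x" "b' = m * y" by (metis of_int_eq_iff of_int_mult)+
    then have "m dvd a'" "m dvd b'" by auto
    then show "\<bar>m\<bar> = 1" using g(3) by (metis coprime_common_divisor zdvd1_eq)
  qed
  then show ?thesis using s pos by (intro exI conjI) auto
qed

text \<open>In the plane an independent pair of rays is maximal, so regularity expresses
  \<open>2 b1\<close> and \<open>2 b2\<close> as integer combinations of the pair, and
  \<open>det_le_2\<close> applies.\<close>

lemma det_rays_le_2:
  assumes reg: "k_regular 2 N R" and R: "\<And>v. v \<in> R \<Longrightarrow> primitive N v"
    and v: "v \<in> R" "w \<in> R" and ab: "v \<bullet> c1 = of_int a" "v \<bullet> c2 = of_int b"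
    and cd: "w \<bullet> c1 = of_int c" "w \<bullet> c2 = of_int d"
  shows "\<bar>a * d - b * c\<bar> \<le> 2"
proof (cases "a * d - b * c = 0")
  case False
  have ne: "v \<noteq> w" using False ab cd by auto
  have "w \<noteq> 0" using False cd by auto
  moreover have "v \<notin> span {w}"
  proof
    assume "v \<in> span {w}"
    then obtain k where "v = k *\<^sub>R w" by (auto simp: span_singleton)
    then have "of_int a = k * of_int c" "of_int b = k * of_int d" using ab cd by auto
    then have "of_int (a * d - b * c) = (0::real)" by simp
    then show False using False of_int_eq_0_iff by blast
  qed
  ultimately have ind: "independent {v, w}" by (simp add: independent_insert)
  have max: "\<not> independent C" if "{v, w} \<subset> C" for C
  proof
    assume "independent C"
    then have "finite C" "card C \<le> 2" using independent_bound[of C] dim by auto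
    then show False using psubset_card_mono[OF _ that] ne by auto
  qed
  have span2: "of_nat 2 *\<^sub>R x \<in> int_span {v, w}" if "x \<in> N" for x
    using reg[unfolded k_regular_def, rule_format, of "{v, w}" x] ind max v that by blast
  have coords: "\<exists>m n. of_int i * 2 = (of_int (m * a + n * c) :: real) \<and> of_int j * 2 = (of_int (m * b + n * d) :: real)"
    for i j :: int
  proof -
    let ?x = "of_int i *\<^sub>R b1 + of_int j *\<^sub>R b2"
    have "?x \<in> N" by (simp add: N_eq)
    then obtain m n where mn: "of_nat 2 *\<^sub>R ?x = of_int m *\<^sub>R v + of_int n *\<^sub>R w"
      using span2 int_span_pair[OF ne] by blast
    have "2 * of_int i = (of_nat 2 *\<^sub>R ?x) \<bullet> c1" "2 * of_int j = (of_nat 2 *\<^sub>R ?x) \<bullet> c2"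
      by (simp_all del: scaleR_add_right)
    then show ?thesis
      unfolding mn using ab cd by (intro exI[of _ m] exI[of _ n]) (simp add: inner_add_left)
  qed
  obtain m n where 1: "2 = m * a + n * c" "0 = m * b + n * d"
    using coords[of 1 0] by (metis mult_1 mult_zero_left of_int_0 of_int_1 of_int_eq_iff of_int_numeral)
  obtain m' n' where 2: "0 = m' * a + n' * c" "2 = m' * b + n' * d"
    using coords[of 0 1] by (metis mult_1 mult_zero_left of_int_0 of_int_1 of_int_eq_iff of_int_numeral)
  obtain a' b' where "v \<bullet> c1 = of_int a'" "v \<bullet> c2 = of_int b'" "coprime a' b'"
    using primitive_coords[OF R[OF v(1)]] .
  then have "coprime a b" using ab by simp
  then show ?thesis by (rule det_le_2[OF 1 2])
qed auto

text \<open>The unimodular vectors \<open>(i, j)\<close> and \<open>(k, l)\<close> give a basis of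
  N. Pairing a ray with \<open>g1\<close> or \<open>g2\<close> is a determinant of the ray with one
  of them, which is bounded by 1.\<close>

lemma adapted_dual_basis:
  assumes reg: "k_regular 2 N R" and R: "\<And>v. v \<in> R \<Longrightarrow> primitive N v"
  obtains g1 g2 h1 h2 where "g1 \<in> dual_lattice N" "g2 \<in> dual_lattice N" "h1 \<in> N" "h2 \<in> N"
    "\<And>u. u = (u \<bullet> h1) *\<^sub>R g1 + (u \<bullet> h2) *\<^sub>R g2"
    "\<And>v. v \<in> R \<Longrightarrow> \<bar>g1 \<bullet> v\<bar> \<le> 1" "\<And>v. v \<in> R \<Longrightarrow> \<bar>g2 \<bullet> v\<bar> \<le> 1"
proof -
  define S where "S = {(a, b). \<exists>v\<in>R. v \<bullet> c1 = of_int a \<and> v \<bullet> c2 = of_int b}"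
  have cop: "coprime a b" if ab: "(a, b) \<in> S" for a b
  proof -
    obtain v where v: "v \<in> R" "v \<bullet> c1 = of_int a" "v \<bullet> c2 = of_int b" using ab by (auto simp: S_def)
    obtain a' b' where "v \<bullet> c1 = of_int a'" "v \<bullet> c2 = of_int b'" "coprime a' b'"
      using primitive_coords[OF R[OF v(1)]] .
    then show ?thesis using v by simp
  qed
  have det: "\<bar>a * d - b * c\<bar> \<le> 2" if "(a, b) \<in> S" "(c, d) \<in> S" for a b c d
    using that det_rays_le_2[OF reg R] unfolding S_def by blast
  obtain i j k l where e: "\<bar>i * l - j * k\<bar> = 1"
    and S: "\<And>x y. (x, y) \<in> S \<Longrightarrow> \<bar>x * l - y * k\<bar> \<le> 1 \<and> \<bar>i * y - j * x\<bar> \<le> 1"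
    using cop det by (rule unimodular_of_small_dets[of S]) (assumption+, rule that, assumption, blast)
  \<comment> \<open>This determinant is 1 or -1; including it in \<open>h1\<close> and
    \<open>h2\<close> makes them exactly dual to \<open>g1\<close> and \<open>g2\<close> for either
    orientation.\<close>
  define \<epsilon> where "\<epsilon> = i * l - j * k"
  define g1 where "g1 = of_int l *\<^sub>R c1 - of_int k *\<^sub>R c2"
  define g2 where "g2 = of_int i *\<^sub>R c2 - of_int j *\<^sub>R c1"
  define h1 where "h1 = of_int (\<epsilon> * i) *\<^sub>R b1 + of_int (\<epsilon> * j) *\<^sub>R b2"
  define h2 where "h2 = of_int (\<epsilon> * k) *\<^sub>R b1 + of_int (\<epsilon> * l) *\<^sub>R b2"
  have "\<epsilon> * \<epsilon> = 1" using e abs_mult_self_eq[of \<epsilon>] unfolding \<epsilon>_def by (metis mult_1)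
  then have ee: "of_int \<epsilon> * of_int \<epsilon> = (1::real)" by (metis of_int_1 of_int_mult)
  have \<epsilon>: "(of_int \<epsilon> :: real) = of_int i * of_int l - of_int j * of_int k" by (simp add: \<epsilon>_def)
  show thesis
  proof (rule that[of g1 g2 h1 h2])
    show "g1 \<in> dual_lattice N" "g2 \<in> dual_lattice N"
      by (simp_all add: dual_lattice_eq g1_def g2_def inner_diff_right inner_commute[of _ b1] inner_commute[of _ b2] dual)
    show "h1 \<in> N" "h2 \<in> N" by (simp_all add: N_eq h1_def h2_def del: of_int_mult)
    show "u = (u \<bullet> h1) *\<^sub>R g1 + (u \<bullet> h2) *\<^sub>R g2" for u
    proof -
      define s t where "s = u \<bullet> b1" and "t = u \<bullet> b2"
      have "(u \<bullet> h1) * l - (u \<bullet> h2) * j = (of_int \<epsilon> * of_int \<epsilon>) * s"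
        unfolding h1_def h2_def \<epsilon> by (simp add: inner_add_right s_def t_def \<epsilon> algebra_simps)
      moreover have "(u \<bullet> h2) * i - (u \<bullet> h1) * k = (of_int \<epsilon> * of_int \<epsilon>) * t"
        unfolding h1_def h2_def \<epsilon> by (simp add: inner_add_right s_def t_def \<epsilon> algebra_simps)
      moreover have "(u \<bullet> h1) *\<^sub>R g1 + (u \<bullet> h2) *\<^sub>R g2
          = ((u \<bullet> h1) * l - (u \<bullet> h2) * j) *\<^sub>R c1 + ((u \<bullet> h2) * i - (u \<bullet> h1) * k) *\<^sub>R c2"
        unfolding g1_def g2_def by (simp add: algebra_simps)
      ultimately have "(u \<bullet> h1) *\<^sub>R g1 + (u \<bullet> h2) *\<^sub>R g2 = s *\<^sub>R c1 + t *\<^sub>R c2"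
        by (simp only: ee mult_1)
      then show ?thesis using dual_expand[of u] by (simp add: s_def t_def)
    qed
    fix v assume v: "v \<in> R"
    obtain a b where ab: "v \<bullet> c1 = of_int a" "v \<bullet> c2 = of_int b"
      using primitive_coords[OF R[OF v]] by metis
    then have "(a, b) \<in> S" using v by (auto simp: S_def)
    then have le: "\<bar>a * l - b * k\<bar> \<le> 1" "\<bar>i * b - j * a\<bar> \<le> 1" using S by auto
    have "g1 \<bullet> v = of_int (a * l - b * k)" "g2 \<bullet> v = of_int (i * b - j * a)"
      using ab by (simp_all add: g1_def g2_def inner_diff_right inner_commute[of _ v] mult.commute)
    then show "\<bar>g1 \<bullet> v\<bar> \<le> 1" "\<bar>g2 \<bullet> v\<bar> \<le> 1" using le by linarith+
  qed
qed

end

section \<open>Residues of least absolute value\<close>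

definition centered_mod :: "int \<Rightarrow> int \<Rightarrow> int" where
  "centered_mod q k = (k + (q - 1) div 2) mod q - (q - 1) div 2"

text \<open>For odd \<open>q\<close> the integers of absolute value at most
  \<open>(q - 1) / 2\<close> number exactly \<open>q\<close>, so they represent every class modulo
  \<open>q\<close> once.\<close>

lemma centered_mod_bound:
  assumes "odd q" "q > 0" shows "\<bar>centered_mod q k\<bar> \<le> (q - 1) div 2"
proof -
  have "0 \<le> (k + (q - 1) div 2) mod q" "(k + (q - 1) div 2) mod q < q" using assms by auto
  moreover have "2 * ((q - 1) div 2) = q - 1" using assms by simp
  ultimately show ?thesis unfolding centered_mod_def by linarith
qed

lemma centered_mod_0 [simp]: "q > 0 \<Longrightarrow> centered_mod q 0 = 0"
  by (simp add: centered_mod_def)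

lemma dvd_centered_mod_diff: "q dvd centered_mod q k - k"
proof -
  have "centered_mod q k - k = - (q * ((k + (q - 1) div 2) div q))"
    using mult_div_mod_eq[of q "k + (q - 1) div 2"] unfolding centered_mod_def by linarith
  then show ?thesis by simp
qed

lemma centered_mod_periodic: "centered_mod q (k + q * m) = centered_mod q k"
  unfolding centered_mod_def by (metis add.assoc add.commute mod_mult_self2)

theorem theorem1p6:
  fixes N :: "'v::euclidean_space set" and \<Sigma> :: "'v set set"
  assumes "DIM('v) = 2"
    and "is_lattice N"
    and "complete_fan N \<Sigma>"
    and "k_regular 2 N (rays N \<Sigma>)"
  shows "\<forall>q::int. odd q \<and> q \<ge> 3 \<longrightarrow> diagonally_split TYPE('k::field) N \<Sigma> q"
proof (intro allI impI)
  fix q :: int assume q: "odd q \<and> q \<ge> 3"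
  then have q0: "q > 0" by simp
  obtain b1 b2 c1 c2 where "plane_lattice N b1 b2 c1 c2"
    using plane_lattice_exists[OF assms(1,2)] .
  then interpret plane_lattice N b1 b2 c1 c2 .
  have fan: "is_fan N \<Sigma>" using assms(3) by (simp add: complete_fan_def)
  have prim: "primitive N v" if "v \<in> rays N \<Sigma>" for v using that by (simp add: rays_def)
  obtain g1 g2 h1 h2 where g: "g1 \<in> dual_lattice N" "g2 \<in> dual_lattice N" and h: "h1 \<in> N" "h2 \<in> N"
    and expand: "\<And>u. u = (u \<bullet> h1) *\<^sub>R g1 + (u \<bullet> h2) *\<^sub>R g2"
    and bound: "\<And>v. v \<in> rays N \<Sigma> \<Longrightarrow> \<bar>g1 \<bullet> v\<bar> \<le> 1" "\<And>v. v \<in> rays N \<Sigma> \<Longrightarrow> \<bar>g2 \<bullet> v\<bar> \<le> 1"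
    using adapted_dual_basis[OF assms(4) prim] by metis
  \<comment> \<open>For lattice \<open>a\<close> and \<open>h\<close> the pairing is an integer and
    the floor only converts its type. The minus sign makes each coordinate of \<open>a + r a\<close>
    divisible by \<open>q\<close>.\<close>
  define \<kappa> where "\<kappa> = (\<lambda>(a::'v) h. centered_mod q (- \<lfloor>a \<bullet> h\<rfloor>) :: int)"
  define r where "r = (\<lambda>a::'v. of_int (\<kappa> a h1) *\<^sub>R g1 + of_int (\<kappa> a h2) *\<^sub>R g2)"
  have coord: "\<exists>m::int. a \<bullet> h = of_int m" if "a \<in> dual_lattice N" "h \<in> N" for a h
    using that by (auto simp: dual_lattice_def elim: Ints_cases)
  interpret diagonal_reps N \<Sigma> "rays N \<Sigma>" q r
  proof
    show "q > 0" by (rule q0)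
    show "0 \<in> N" by (simp add: N_eq)
    show "rays N \<Sigma> \<subseteq> N" by (auto simp: rays_def primitive_def)
    show "convex_cone \<sigma>" if "\<sigma> \<in> \<Sigma>" for \<sigma>
      using fan that convex_cone_convex_cone_hull unfolding is_fan_def rational_cone_def by metis
    show "u \<in> dual_cone \<sigma>" if "\<sigma> \<in> \<Sigma>" "\<And>v. v \<in> rays N \<Sigma> \<inter> \<sigma> \<Longrightarrow> 0 \<le> u \<bullet> v" for \<sigma> u
      using dual_cone_rays[OF primitive_generator fan that] .
    show "r 0 = 0" using q0 by (simp add: r_def \<kappa>_def)
  next
    fix a assume a: "a \<in> dual_lattice N"
    have "\<exists>n::int. a \<bullet> h + of_int (\<kappa> a h) = of_int q * of_int n" if hN: "h \<in> N" for h
    proof -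
      obtain m where m: "a \<bullet> h = of_int m" using coord[OF a hN] by blast
      obtain n where "centered_mod q (- m) - - m = q * n" using dvd_centered_mod_diff by (metis dvdE)
      then have "m + centered_mod q (- m) = q * n" by simp
      then show ?thesis unfolding \<kappa>_def m floor_of_int by (metis of_int_add of_int_mult)
    qed
    then obtain m n where mn: "a \<bullet> h1 + of_int (\<kappa> a h1) = of_int q * of_int m" "a \<bullet> h2 + of_int (\<kappa> a h2) = of_int q * of_int n"
      using h by metis
    have "a + r a = (a \<bullet> h1 + of_int (\<kappa> a h1)) *\<^sub>R g1 + (a \<bullet> h2 + of_int (\<kappa> a h2)) *\<^sub>R g2"
      by (subst expand[of a]) (simp add: r_def scaleR_add_left)
    then have "(1 / of_int q) *\<^sub>R (a + r a) = of_int m *\<^sub>R g1 + of_int n *\<^sub>R g2"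
      unfolding mn using q0 by (simp add: scaleR_add_right)
    then show "(1 / of_int q) *\<^sub>R (a + r a) \<in> dual_lattice N"
      using g by (simp add: dual_lattice_add dual_lattice_scaleR)
  next
    fix a c assume a: "a \<in> dual_lattice N" and c: "c \<in> dual_lattice N"
    have "\<kappa> (of_int q *\<^sub>R c + a) h = \<kappa> a h" if hN: "h \<in> N" for h
    proof -
      obtain m n where mn: "a \<bullet> h = of_int m" "c \<bullet> h = of_int n" using coord[OF a hN] coord[OF c hN] by blast
      then have "(of_int q *\<^sub>R c + a) \<bullet> h = of_int (- (- m + q * - n))" by (simp add: inner_add_left)
      then have "\<kappa> (of_int q *\<^sub>R c + a) h = centered_mod q (- m + q * - n)"
        by (simp only: \<kappa>_def floor_of_int minus_minus)
      also have "\<dots> = \<kappa> a h"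
        using centered_mod_periodic[of q "- m" "- n"] by (simp add: \<kappa>_def mn)
      finally show ?thesis .
    qed
    then show "r (of_int q *\<^sub>R c + a) = r a" using h by (simp add: r_def)
  next
    fix a v assume v: "v \<in> rays N \<Sigma>"
    have \<kappa>: "\<bar>of_int (\<kappa> a h)\<bar> \<le> (of_int ((q - 1) div 2) :: real)" for h
      using centered_mod_bound[of q] q unfolding \<kappa>_def by (metis of_int_abs of_int_le_iff q0)
    have "\<bar>r a \<bullet> v\<bar> \<le> \<bar>of_int (\<kappa> a h1)\<bar> * \<bar>g1 \<bullet> v\<bar> + \<bar>of_int (\<kappa> a h2)\<bar> * \<bar>g2 \<bullet> v\<bar>"
      unfolding r_def inner_add_left inner_scaleR_left abs_mult[symmetric] by (rule abs_triangle_ineq)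
    \<comment> \<open>Each of the two coordinates contributes at most \<open>(q - 1) / 2\<close>;
      the total \<open>q - 1\<close> is strictly below \<open>q\<close>.\<close>
    also have "\<dots> \<le> of_int ((q - 1) div 2) * 1 + of_int ((q - 1) div 2) * 1"
      using \<kappa> bound[OF v] q0 by (intro add_mono mult_mono) auto
    also have "\<dots> = of_int (2 * ((q - 1) div 2))" by simp
    also have "2 * ((q - 1) div 2) = q - 1" using q by simp
    finally show "\<bar>r a \<bullet> v\<bar> < of_int q" by simp
  qed
  show "diagonally_split TYPE('k) N \<Sigma> q" by (rule diagonally_split_of_reps)
qed

end
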